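(* There exists a block structured sparsity model $\mathbb{M}_{\mathrm{block}}$ (with $J$ rows, $N$ columns and block sparsity $K$, so $s=JK$, $d=JN$) such that, in each of the following settings, with $\beta^*$ drawn uniformly at random from a suitable finite set of signals with supports in $\mathbb{M}_{\mathrm{block}}$, and irrespective of the procedure used to infer $\hat\beta$ from $(X,y)$: 1. If $n\in\tilde{o}(KJ+K\log\frac NK)$ then $\mathbb{P}(\|\beta^*-\hat\beta\|\ge C\|e\|)\ge\frac1{10}$ for noisy standard compressed sensing, for all $0<C\le C_0$, where $C_0>0$ is a constant. 2. If $n\in\tilde{o}(KJ+K\log\frac NK)$ then $\mathbb{P}(\beta^*\ne\hat\beta)\ge\frac12$ for noiseless standard compressed sensing. 3. If $n\in o(KJ+K\log\frac NK)$ then $\mathbb{P}\Big(\Big\|\frac{\hat\beta}{\|\hat\beta\|}-\frac{\beta^*}{\|\beta^*\|}\Big\|\ge\epsilon\Big)\ge\frac12$ for one-bit compressed sensing, for some $\epsilon>0$ (not depending on the procedure). 4. If $n\in o(KJ+K\log\frac NK)$ then $\mathbb{P}(\hat\beta\ne\beta^* )\ge\frac12$ for one-bit compressed sensing.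
   Context: Block sparsity model. A signal $\beta\in\mathbb{R}^{J\times N}$ is viewed as a matrix with $J$ rows and $N$ columns (equivalently a vector in $\mathbb{R}^d$, $d=JN$); the index $ij$ denotes the entry in row $i$ and column $j$. Supports consist of $K$ full columns, $s=JK$: $\mathbb{M}_{\mathrm{block}}$ is the set of all $S=\{ij : i\in[J],\ j\in L\}$ with $L\subseteq\{1,\dots,N\}$, $|L|=K$. Observation settings ($n$ i.i.d. observations, $X\in\mathbb{R}^{n\times d}$, with $\beta^*$, $X$, $e$ independent): - Noisy standard compressed sensing: $y=X\beta^*+e$, $X$ has i.i.d. $\mathcal{N}(0,1/n)$ entries, $e$ has i.i.d. $\mathcal{N}(0,\sigma^2)$ entries. - Noiseless standard compressed sensing: $y=X\beta^*$, $X$ has i.i.d. entries equal to $\pm 1/\sqrt n$ with probability $\frac12$ each. - One-bit compressed sensing: $y=\operatorname{sign}(X\beta^*+e)\in\{-1,+1\}^n$ (coordinatewise, any fixed convention at $0$), $X$ has i.i.d. $\mathcal{N}(0,1/n)$ entries, and $e$ either has i.i.d. $\mathcal{N}(0,\sigma^2)$ entries or is $0$. $\|\cdot\|$ is the $\ell_2$-norm. In each setting nature draws $\beta^*$ uniformly at random from a finite set of $s$-sparse signals whose supports lie in the model and whose non-zero entries take values in a particular finite set (which may depend on the setting and on the problem parameters, including $n$ and $\sigma$). A procedure is any (possibly randomized) measurable map from $(X,y)$ to $\hat\beta\in\mathbb{R}^d$ (nonzero in item 3). Asymptotic convention. "A model" is a family of models indexed by $m\in\mathbb{N}$ (with $J,N,K$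 depending on $m$) along which $\Phi=KJ+K\log\frac NK$ and $\Phi/\log s$ tend to infinity; $C_0$ does not depend on $m$, while $\epsilon$ may. $\tilde{o}$ hides a factor logarithmic in $s$: $n\in\tilde{o}(\Phi)$ means $n\in o(\Phi/\log s)$. "If $n\in o(\Psi)$ then $P$" means: for every sequence of positive integers $n_m$ with $n_m/\Psi_m\to0$, $P$ holds for all sufficiently large $m$. *)

theory Defs
  imports "HOL-Probability.Probability" "HOL-Library.Landau_Symbols"
begin

text \<open>
  A signal in \<open>\<real>\<^sup>J\<^sup>\<times>\<^sup>N\<close> is an extensional function on \<open>grid J N\<close>; \<open>(i, j)\<close> is the entry in row \<open>i\<close>
  and column \<open>j\<close>. The \<open>\<ell>\<^sub>2\<close>-norm over a finite index set is the library's \<^const>\<open>L2_set\<close>.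
\<close>

type_synonym signal = "nat \<times> nat \<Rightarrow> real"
type_synonym design = "nat \<times> nat \<times> nat \<Rightarrow> real"

definition grid :: "nat \<Rightarrow> nat \<Rightarrow> (nat \<times> nat) set" where
  "grid J N = {1..J} \<times> {1..N}"

definition block_model :: "nat \<Rightarrow> nat \<Rightarrow> nat \<Rightarrow> (nat \<times> nat) set set" where
  "block_model J N K = {{1..J} \<times> L | L. L \<subseteq> {1..N} \<and> card L = K}"

definition support :: "nat \<Rightarrow> nat \<Rightarrow> signal \<Rightarrow> (nat \<times> nat) set" where
  "support J N \<beta> = {p \<in> grid J N. \<beta> p \<noteq> 0}"

text \<open>Membership of the support in the model already makes a signal \<open>J * K\<close>-sparse.\<close>

definition block_signals :: "nat \<Rightarrow> nat \<Rightarrow> nat \<Rightarrow> real set \<Rightarrow> signal set" where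
  "block_signals J N K V =
     {\<beta> \<in> grid J N \<rightarrow>\<^sub>E UNIV. support J N \<beta> \<in> block_model J N K \<and> \<beta> ` support J N \<beta> \<subseteq> V}"

definition signal_ensemble :: "nat \<Rightarrow> nat \<Rightarrow> nat \<Rightarrow> signal set \<Rightarrow> bool" where
  "signal_ensemble J N K B \<longleftrightarrow>
     finite B \<and> B \<noteq> {} \<and> (\<exists>V. finite V \<and> B \<subseteq> block_signals J N K V)"

definition complexity :: "nat \<Rightarrow> nat \<Rightarrow> nat \<Rightarrow> real" where
  "complexity J N K = real K * real J + real K * ln (real N / real K)"

definition block_family :: "(nat \<Rightarrow> nat) \<Rightarrow> (nat \<Rightarrow> nat) \<Rightarrow> (nat \<Rightarrow> nat) \<Rightarrow> bool" where
  "block_family J N K \<longleftrightarrow>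
     (\<forall>m. 1 \<le> J m \<and> 1 \<le> K m \<and> K m \<le> N m) \<and>
     filterlim (\<lambda>m. complexity (J m) (N m) (K m)) at_top sequentially \<and>
     filterlim (\<lambda>m. complexity (J m) (N m) (K m) / ln (real (J m * K m))) at_top sequentially"

definition signal_space :: "nat \<Rightarrow> nat \<Rightarrow> signal measure" where
  "signal_space J N = Pi\<^sub>M (grid J N) (\<lambda>_. borel)"

definition design_space :: "nat \<Rightarrow> nat \<Rightarrow> nat \<Rightarrow> design measure" where
  "design_space J N n = Pi\<^sub>M ({1..n} \<times> grid J N) (\<lambda>_. borel)"

definition obs_space :: "nat \<Rightarrow> (nat \<Rightarrow> real) measure" where
  "obs_space n = Pi\<^sub>M {1..n} (\<lambda>_. borel)"

text \<open>
  \<open>normal_law \<sigma>\<close> is \<open>\<N>(0, \<sigma>\<^sup>2)\<close>. The case \<open>\<sigma> = 0\<close> is separate because \<open>normal_density 0 0\<close> is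
  identically \<open>0\<close> in the library; it serves as the noiseless case.
\<close>

definition normal_law :: "real \<Rightarrow> real measure" where
  "normal_law \<sigma> =
     (if \<sigma> = 0 then return borel 0 else density lborel (\<lambda>x. ennreal (normal_density 0 \<sigma> x)))"

definition noise_law :: "nat \<Rightarrow> real \<Rightarrow> (nat \<Rightarrow> real) measure" where
  "noise_law n \<sigma> = Pi\<^sub>M {1..n} (\<lambda>_. normal_law \<sigma>)"

definition gaussian_design :: "nat \<Rightarrow> nat \<Rightarrow> nat \<Rightarrow> design measure" where
  "gaussian_design J N n = Pi\<^sub>M ({1..n} \<times> grid J N) (\<lambda>_. normal_law (1 / sqrt (real n)))"

definition rademacher_design :: "nat \<Rightarrow> nat \<Rightarrow> nat \<Rightarrow> design measure" where
  "rademacher_design J N n =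
     Pi\<^sub>M ({1..n} \<times> grid J N)
       (\<lambda>_. distr (measure_pmf (pmf_of_set {1 / sqrt (real n), - 1 / sqrt (real n)})) borel (\<lambda>x. x))"

text \<open>The link \<open>h\<close> is the identity for standard and a sign function for one-bit sensing.\<close>

definition observe ::
  "nat \<Rightarrow> nat \<Rightarrow> nat \<Rightarrow> (real \<Rightarrow> real) \<Rightarrow> design \<Rightarrow> signal \<Rightarrow> (nat \<Rightarrow> real) \<Rightarrow> nat \<Rightarrow> real" where
  "observe J N n h X \<beta> e = (\<lambda>i\<in>{1..n}. h ((\<Sum>p\<in>grid J N. X (i, p) * \<beta> p) + e i))"

text \<open>The argument \<open>c\<close> is the value assigned to the sign of \<open>0\<close>.\<close>

definition sign_with :: "real \<Rightarrow> real \<Rightarrow> real" where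
  "sign_with c x = (if x = 0 then c else sgn x)"

text \<open>
  A randomized procedure is a Markov kernel from the data \<open>(X, y)\<close> to signals; deterministic
  measurable maps are the kernels whose values are point masses.
\<close>

type_synonym kernel = "design \<times> (nat \<Rightarrow> real) \<Rightarrow> signal measure"

definition procedures :: "nat \<Rightarrow> nat \<Rightarrow> nat \<Rightarrow> kernel set" where
  "procedures J N n =
     (design_space J N n \<Otimes>\<^sub>M obs_space n) \<rightarrow>\<^sub>M prob_algebra (signal_space J N)"

definition nonzero_procedures :: "nat \<Rightarrow> nat \<Rightarrow> nat \<Rightarrow> kernel set" where
  "nonzero_procedures J N n =
     {\<kappa> \<in> procedures J N n. \<forall>z \<in> space (design_space J N n \<Otimes>\<^sub>M obs_space n).
        AE b in \<kappa> z. \<exists>p\<in>grid J N. b p \<noteq> 0}"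

text \<open>
  Joint law of \<open>(\<beta>\<^sup>*, X, e, b)\<close>, where \<open>\<beta>\<^sup>*\<close> is uniform on \<open>B\<close>, the three variables \<open>\<beta>\<^sup>*\<close>, \<open>X\<close>, \<open>e\<close>
  are independent, and the estimate \<open>b\<close> is drawn by \<open>\<kappa>\<close> from \<open>X\<close> and the observations.
\<close>

definition joint_law ::
  "nat \<Rightarrow> nat \<Rightarrow> nat \<Rightarrow> (real \<Rightarrow> real) \<Rightarrow> design measure \<Rightarrow> (nat \<Rightarrow> real) measure \<Rightarrow>
   signal set \<Rightarrow> kernel \<Rightarrow> (signal \<times> design \<times> (nat \<Rightarrow> real) \<times> signal) measure" where
  "joint_law J N n h D E B \<kappa> =
     do {
       \<beta> \<leftarrow> uniform_count_measure B;
       X \<leftarrow> D;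
       e \<leftarrow> E;
       b \<leftarrow> \<kappa> (X, observe J N n h X \<beta> e);
       return (signal_space J N \<Otimes>\<^sub>M design_space J N n \<Otimes>\<^sub>M obs_space n \<Otimes>\<^sub>M signal_space J N)
         (\<beta>, X, e, b)
     }"

definition noisy_law :: "nat \<Rightarrow> nat \<Rightarrow> nat \<Rightarrow> real \<Rightarrow> signal set \<Rightarrow> kernel \<Rightarrow>
    (signal \<times> design \<times> (nat \<Rightarrow> real) \<times> signal) measure" where
  "noisy_law J N n \<sigma> = joint_law J N n (\<lambda>x. x) (gaussian_design J N n) (noise_law n \<sigma>)"

definition noiseless_law :: "nat \<Rightarrow> nat \<Rightarrow> nat \<Rightarrow> signal set \<Rightarrow> kernel \<Rightarrow>
    (signal \<times> design \<times> (nat \<Rightarrow> real) \<times> signal) measure" where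
  "noiseless_law J N n = joint_law J N n (\<lambda>x. x) (rademacher_design J N n) (noise_law n 0)"

definition one_bit_law :: "nat \<Rightarrow> nat \<Rightarrow> nat \<Rightarrow> real \<Rightarrow> real \<Rightarrow> signal set \<Rightarrow> kernel \<Rightarrow>
    (signal \<times> design \<times> (nat \<Rightarrow> real) \<times> signal) measure" where
  "one_bit_law J N n \<sigma> c =
     joint_law J N n (sign_with c) (gaussian_design J N n) (noise_law n \<sigma>)"

end

theory Submission
  imports Defs "HOL-Real_Asymp.Real_Asymp"
begin

text \<open>
  Take two rows, block sparsity one and \<open>N\<close> columns, so that the complexity is \<open>2 + ln N\<close>, and let the
  signal be \<open>a\<close> on one uniformly chosen column. An estimate is close to at most one of these \<open>N\<close>
  signals. If the observations take at most \<open>L\<close> values for a given design, then for every design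
  the success probabilities of the \<open>N\<close> signals add up to at most \<open>L\<close>; here \<open>L\<close> is \<open>2 ^ n\<close> for
  signs and \<open>3 ^ n\<close> for sums of two random signs, both negligible against \<open>N\<close>.

  For Gaussian noise, \<open>a\<close> is chosen of order \<open>\<sigma> * sqrt n\<close>. Off two events of probability at most
  \<open>1 / 10\<close> (Markov for \<open>\<parallel>e\<parallel>\<^sup>2\<close> and for the squares of the design in the chosen column), a successful
  estimate is close to the signal and \<open>\<parallel>y\<parallel>\<^sup>2\<close> is of order \<open>n * \<sigma>\<^sup>2\<close>. There the density of \<open>y\<close> is at most
  \<open>exp (1610 * n)\<close> times the density of pure noise, so \<open>exp (1610 * n)\<close> plays the role of \<open>L\<close>.
\<close>

section \<open>The joint law and the counting bound\<close>

lemma space_signal_space: "space (signal_space J N) = grid J N \<rightarrow>\<^sub>E UNIV"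
  by (simp add: signal_space_def space_PiM)

lemma finite_grid [simp]: "finite (grid J N)"
  by (simp add: grid_def)

lemma measurable_observe [measurable]:
  assumes [measurable]: "h \<in> borel_measurable borel"
  shows "(\<lambda>z. observe J N n h (fst z) \<beta> (snd z)) \<in> design_space J N n \<Otimes>\<^sub>M obs_space n \<rightarrow>\<^sub>M obs_space n"
  unfolding observe_def design_space_def obs_space_def by measurable

lemma measurable_signal_component:
  "p \<in> grid J N \<Longrightarrow> (\<lambda>b. b p) \<in> borel_measurable (signal_space J N)"
  unfolding signal_space_def by (rule measurable_component_singleton)

text \<open>The settings differ only in the link, the design law, the noise law and the signal set,
  so the joint law is analysed once for all of them. Laws are points of
  \<open>space (prob_algebra _)\<close>, which carries total mass one and the sigma-algebra in the
  form that the rules for \<open>bind\<close> take.\<close>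

locale sensing =
  fixes J N n :: nat and h :: "real \<Rightarrow> real" and D :: "design measure"
    and E :: "(nat \<Rightarrow> real) measure" and B :: "signal set" and \<kappa> :: kernel
  assumes D: "D \<in> space (prob_algebra (design_space J N n))"
    and E: "E \<in> space (prob_algebra (obs_space n))"
    and h [measurable]: "h \<in> borel_measurable borel"
    and B: "finite B" "B \<noteq> {}" "B \<subseteq> space (signal_space J N)"
    and kernel: "\<kappa> \<in> procedures J N n"
begin

abbreviation "S \<equiv> signal_space J N"

abbreviation "T \<equiv> S \<Otimes>\<^sub>M design_space J N n \<Otimes>\<^sub>M obs_space n \<Otimes>\<^sub>M S"

abbreviation "estimate \<beta> X e \<equiv> \<kappa> (X, observe J N n h X \<beta> e)"

lemma kernel_measurable [measurable]:
  "\<kappa> \<in> design_space J N n \<Otimes>\<^sub>M obs_space n \<rightarrow>\<^sub>M prob_algebra S"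
  using kernel by (simp add: procedures_def)

lemma sets_D [measurable_cong, simp]: "sets D = sets (design_space J N n)"
  and sets_E [measurable_cong, simp]: "sets E = sets (obs_space n)"
  using D E by (auto simp: space_prob_algebra)

lemma space_D [simp]: "space D = space (design_space J N n)"
  and space_E [simp]: "space E = space (obs_space n)"
  using sets_eq_imp_space_eq[OF sets_D] sets_eq_imp_space_eq[OF sets_E] by auto

sublocale D: prob_space D using D by (simp add: space_prob_algebra)

sublocale E: prob_space E using E by (simp add: space_prob_algebra)

lemma observe_space: "observe J N n h X \<beta> e \<in> space (obs_space n)"
  by (auto simp: observe_def obs_space_def space_PiM)

lemma estimate_prob:
  assumes "X \<in> space (design_space J N n)" "y \<in> space (obs_space n)"
  shows "prob_space (\<kappa> (X, y))" "sets (\<kappa> (X, y)) = sets S"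
  using measurable_space[OF kernel_measurable, of "(X, y)"] assms
  by (auto simp: space_pair_measure space_prob_algebra)

lemma estimate_measurable [measurable]:
  "(\<lambda>z. estimate \<beta> (fst z) (snd z)) \<in> design_space J N n \<Otimes>\<^sub>M obs_space n \<rightarrow>\<^sub>M prob_algebra S"
  by measurable

lemma kernel_into_joint:
  assumes [measurable]: "\<beta> \<in> space S"
  shows "(\<lambda>z. estimate \<beta> (fst z) (snd z) \<bind> (\<lambda>b. return T (\<beta>, fst z, snd z, b)))
    \<in> design_space J N n \<Otimes>\<^sub>M obs_space n \<rightarrow>\<^sub>M prob_algebra T"
  by measurable

text \<open>Each layer of the nested \<open>bind\<close> must be a probability kernel in the
  variables drawn before it. Once the noise is integrated out, a kernel in the design alone
  remains.\<close>

lemma noise_into_joint: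
  assumes \<beta>: "\<beta> \<in> space S"
  shows "(\<lambda>X. E \<bind> (\<lambda>e. estimate \<beta> X e \<bind> (\<lambda>b. return T (\<beta>, X, e, b))))
    \<in> design_space J N n \<rightarrow>\<^sub>M prob_algebra T"
  using kernel_into_joint[OF \<beta>] E
  by (intro measurable_bind_prob_space2[where N = "obs_space n"] measurable_const)
    (auto simp: case_prod_beta')

definition conditional_law :: "signal \<Rightarrow> (signal \<times> design \<times> (nat \<Rightarrow> real) \<times> signal) measure" where
  "conditional_law \<beta> =
    D \<bind> (\<lambda>X. E \<bind> (\<lambda>e. estimate \<beta> X e \<bind> (\<lambda>b. return T (\<beta>, X, e, b))))"

lemma conditional_law_prob:
  assumes "\<beta> \<in> space S"
  shows "conditional_law \<beta> \<in> space (prob_algebra T)"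
  using prob_space_bind'[OF D noise_into_joint[OF assms]] sets_bind'[OF D noise_into_joint[OF assms]]
  by (simp add: conditional_law_def space_prob_algebra)

lemma emeasure_bind_estimate:
  assumes \<beta>: "\<beta> \<in> space S" and A: "A \<in> sets T"
    and X: "X \<in> space (design_space J N n)" and e: "e \<in> space (obs_space n)"
  shows "emeasure (estimate \<beta> X e \<bind> (\<lambda>b. return T (\<beta>, X, e, b))) A =
    emeasure (estimate \<beta> X e) {b \<in> space S. (\<beta>, X, e, b) \<in> A}"
proof -
  have m: "(\<lambda>b. (\<beta>, X, e, b)) \<in> S \<rightarrow>\<^sub>M T"
    using \<beta> X e by (intro measurable_Pair measurable_const measurable_ident) auto
  have p: "estimate \<beta> X e \<in> space (prob_algebra S)"
    using estimate_prob[OF X observe_space] by (simp add: space_prob_algebra)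
  have sp: "space (estimate \<beta> X e) = space S"
    by (rule sets_eq_imp_space_eq[OF estimate_prob(2)[OF X observe_space]])
  have s: "{b \<in> space S. (\<beta>, X, e, b) \<in> A} \<in> sets S"
    using measurable_sets[OF m A] by (simp add: vimage_def Int_def conj_commute)
  have "emeasure (estimate \<beta> X e \<bind> (\<lambda>b. return T (\<beta>, X, e, b))) A =
      (\<integral>\<^sup>+b. emeasure (return T (\<beta>, X, e, b)) A \<partial>estimate \<beta> X e)"
    by (rule emeasure_bind_prob_algebra[OF p measurable_compose[OF m measurable_return_prob_space] A])
  \<comment> \<open>The point mass at the full tuple, evaluated on \<open>A\<close>, is the
    indicator of the section of \<open>A\<close> at the fixed signal, design and noise.\<close>
  also have "\<dots> = (\<integral>\<^sup>+b. indicator {b \<in> space S. (\<beta>, X, e, b) \<in> A} b \<partial>estimate \<beta> X e)"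
  proof (rule nn_integral_cong)
    fix b assume "b \<in> space (estimate \<beta> X e)"
    then show "emeasure (return T (\<beta>, X, e, b)) A = indicator {b \<in> space S. (\<beta>, X, e, b) \<in> A} b"
      unfolding emeasure_return[OF A] sp by (simp add: indicator_def)
  qed
  also have "\<dots> = emeasure (estimate \<beta> X e) {b \<in> space S. (\<beta>, X, e, b) \<in> A}"
    using s by (intro nn_integral_indicator) (simp only: estimate_prob(2)[OF X observe_space])
  finally show ?thesis .
qed

lemma emeasure_conditional_law:
  assumes \<beta>: "\<beta> \<in> space S" and A: "A \<in> sets T"
  shows "emeasure (conditional_law \<beta>) A =
    (\<integral>\<^sup>+X. \<integral>\<^sup>+e. emeasure (estimate \<beta> X e) {b \<in> space S. (\<beta>, X, e, b) \<in> A} \<partial>E \<partial>D)"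
  unfolding conditional_law_def emeasure_bind_prob_algebra[OF D noise_into_joint[OF \<beta>] A]
proof (rule nn_integral_cong)
  fix X assume "X \<in> space D"
  then have X: "X \<in> space (design_space J N n)" by simp
  have m: "(\<lambda>e. estimate \<beta> X e \<bind> (\<lambda>b. return T (\<beta>, X, e, b))) \<in> obs_space n \<rightarrow>\<^sub>M prob_algebra T"
    using measurable_compose[OF measurable_Pair1'[OF X] kernel_into_joint[OF \<beta>]]
    by (simp only: fst_conv snd_conv)
  show "emeasure (E \<bind> (\<lambda>e. estimate \<beta> X e \<bind> (\<lambda>b. return T (\<beta>, X, e, b)))) A =
      (\<integral>\<^sup>+e. emeasure (estimate \<beta> X e) {b \<in> space S. (\<beta>, X, e, b) \<in> A} \<partial>E)"
    unfolding emeasure_bind_prob_algebra[OF E m A]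
    by (rule nn_integral_cong) (simp only: space_E emeasure_bind_estimate[OF \<beta> A X])
qed

lemma joint_law_altdef: "joint_law J N n h D E B \<kappa> = uniform_count_measure B \<bind> conditional_law"
  by (simp add: joint_law_def conditional_law_def [abs_def])

lemma uniform_prob: "uniform_count_measure B \<in> space (prob_algebra (count_space B))"
  using B prob_space_uniform_count_measure[of B]
  by (simp add: space_prob_algebra sets_uniform_count_measure_count_space)

text \<open>The signals in \<open>B\<close> carry the discrete sigma-algebra, so measurability in
  the signal reduces to each conditional law being a probability law on \<open>T\<close>.\<close>

lemma conditional_law_measurable: "conditional_law \<in> count_space B \<rightarrow>\<^sub>M prob_algebra T"
  using conditional_law_prob B(3) by auto

lemma prob_space_joint_law: "prob_space (joint_law J N n h D E B \<kappa>)"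
  and sets_joint_law: "sets (joint_law J N n h D E B \<kappa>) = sets T"
  unfolding joint_law_altdef
  using prob_space_bind'[OF uniform_prob conditional_law_measurable]
    sets_bind'[OF uniform_prob conditional_law_measurable] by auto

lemma emeasure_joint_law:
  assumes A: "A \<in> sets T"
  shows "emeasure (joint_law J N n h D E B \<kappa>) A =
    (\<Sum>\<beta>\<in>B. \<integral>\<^sup>+X. \<integral>\<^sup>+e. emeasure (estimate \<beta> X e) {b \<in> space S. (\<beta>, X, e, b) \<in> A} \<partial>E \<partial>D)
      * ennreal (1 / card B)"
  unfolding joint_law_altdef
    emeasure_bind_prob_algebra[OF uniform_prob conditional_law_measurable A]
  unfolding uniform_count_measure_def nn_integral_point_measure_finite[OF B(1)] sum_distrib_right
proof (rule sum.cong[OF refl])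
  fix \<beta> assume "\<beta> \<in> B"
  then have "\<beta> \<in> space S" using B(3) by blast
  from emeasure_conditional_law[OF this A]
  show "ennreal (1 / card B) * emeasure (conditional_law \<beta>) A =
      (\<integral>\<^sup>+X. \<integral>\<^sup>+e. emeasure (estimate \<beta> X e) {b \<in> space S. (\<beta>, X, e, b) \<in> A} \<partial>E \<partial>D) * ennreal (1 / card B)"
    by (simp only: mult.commute)
qed

text \<open>Passing to the complement: the counting arguments bound the success of an estimate,
  summed over the signals, and the uniform weight \<open>1 / card B\<close> turns a bound
  \<open>q * card B\<close> on that sum into the probability \<open>q\<close>.\<close>

lemma prob_joint_law_ge:
  fixes q :: real
  assumes P: "{\<omega> \<in> space T. P (fst \<omega>) (fst (snd \<omega>)) (fst (snd (snd \<omega>))) (snd (snd (snd \<omega>)))} \<in> sets T" and q: "0 \<le> q"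
    and le: "(\<Sum>\<beta>\<in>B. \<integral>\<^sup>+X. \<integral>\<^sup>+e. emeasure (estimate \<beta> X e) {b \<in> space S. \<not> P \<beta> X e b} \<partial>E \<partial>D)
      \<le> ennreal (q * card B)"
  shows "1 - q \<le> \<P>((\<beta>, X, e, b) in joint_law J N n h D E B \<kappa>. P \<beta> X e b)"
proof -
  let ?P = "\<lambda>\<omega>. P (fst \<omega>) (fst (snd \<omega>)) (fst (snd (snd \<omega>))) (snd (snd (snd \<omega>)))"
  let ?M = "joint_law J N n h D E B \<kappa>"
  interpret prob_space ?M by (rule prob_space_joint_law)
  have sp: "space ?M = space T" using sets_joint_law by (rule sets_eq_imp_space_eq)
  have P': "{\<omega> \<in> space ?M. ?P \<omega>} \<in> sets ?M" using P sets_joint_law sp by simp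
  have nP: "{\<omega> \<in> space T. \<not> ?P \<omega>} \<in> sets T"
    using sets.Diff[OF sets.top P] by (simp add: set_diff_eq cong: conj_cong)
  have "emeasure ?M {\<omega> \<in> space T. \<not> ?P \<omega>} = (\<Sum>\<beta>\<in>B. \<integral>\<^sup>+X. \<integral>\<^sup>+e. emeasure (estimate \<beta> X e)
      {b \<in> space S. \<not> P \<beta> X e b} \<partial>E \<partial>D) * ennreal (1 / card B)"
    unfolding emeasure_joint_law[OF nP] using B(3)
    by (intro arg_cong2[of _ _ _ _ "(*)"] refl sum.cong nn_integral_cong arg_cong2[of _ _ _ _ emeasure])
      (auto simp: space_pair_measure)
  also have "\<dots> \<le> ennreal (q * card B) * ennreal (1 / card B)"
    by (intro mult_right_mono le) auto
  also have "\<dots> = ennreal q"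
  proof -
    have "ennreal (q * card B) * ennreal (1 / card B) = ennreal (q * card B * (1 / card B))"
      using q by (intro ennreal_mult [symmetric]) auto
    moreover have "q * card B * (1 / card B) = q" using B by simp
    ultimately show ?thesis by simp
  qed
  finally have "prob {\<omega> \<in> space ?M. \<not> ?P \<omega>} \<le> q"
    using q by (simp add: sp emeasure_eq_measure)
  moreover have "prob {\<omega> \<in> space ?M. \<not> ?P \<omega>} = 1 - prob {\<omega> \<in> space ?M. ?P \<omega>}"
    using prob_neg[OF P'] .
  moreover have "{(\<beta>, X, e, b) \<in> space ?M. P \<beta> X e b} = {\<omega> \<in> space ?M. ?P \<omega>}" by auto
  ultimately show ?thesis by simp
qed

text \<open>The estimate from given data has a single law, whatever signal produced the data; its
  masses on disjoint success sets cannot add up to more than one.\<close>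

lemma kernel_disjoint_le_1:
  assumes G: "\<And>\<beta>. \<beta> \<in> B \<Longrightarrow> G \<beta> \<in> sets S" and dis: "disjoint_family_on G B"
    and z: "X \<in> space (design_space J N n)" "y \<in> space (obs_space n)"
  shows "(\<Sum>\<beta>\<in>B. emeasure (\<kappa> (X, y)) (G \<beta>)) \<le> 1"
proof -
  interpret K: prob_space "\<kappa> (X, y)" by (rule estimate_prob[OF z])
  have "(\<Sum>\<beta>\<in>B. emeasure (\<kappa> (X, y)) (G \<beta>)) = emeasure (\<kappa> (X, y)) (\<Union>\<beta>\<in>B. G \<beta>)"
    using G dis B(1) by (intro sum_emeasure) (auto simp: estimate_prob(2)[OF z])
  also have "\<dots> \<le> 1" by (rule K.emeasure_le_1)
  finally show ?thesis .
qed

text \<open>With the sum over the signals innermost, bounds valid for each fixed design and noise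
  can be applied under the integrals.\<close>

lemma sum_nn_integral_swap:
  fixes g :: "signal \<Rightarrow> design \<Rightarrow> (nat \<Rightarrow> real) \<Rightarrow> ennreal"
  assumes "\<And>\<beta>. \<beta> \<in> B \<Longrightarrow>
    (\<lambda>z. g \<beta> (fst z) (snd z)) \<in> borel_measurable (design_space J N n \<Otimes>\<^sub>M obs_space n)"
  shows "(\<Sum>\<beta>\<in>B. \<integral>\<^sup>+X. \<integral>\<^sup>+e. g \<beta> X e \<partial>E \<partial>D) = (\<integral>\<^sup>+X. \<integral>\<^sup>+e. (\<Sum>\<beta>\<in>B. g \<beta> X e) \<partial>E \<partial>D)"
proof -
  have g: "(\<lambda>z. g \<beta> (fst z) (snd z)) \<in> borel_measurable (D \<Otimes>\<^sub>M E)" if "\<beta> \<in> B" for \<beta>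
    using assms[OF that]
    by (simp only: measurable_cong_sets[OF sets_pair_measure_cong[OF sets_D sets_E] refl])
  have "(\<Sum>\<beta>\<in>B. \<integral>\<^sup>+X. \<integral>\<^sup>+e. g \<beta> X e \<partial>E \<partial>D) = (\<integral>\<^sup>+X. (\<Sum>\<beta>\<in>B. \<integral>\<^sup>+e. g \<beta> X e \<partial>E) \<partial>D)"
  proof (rule nn_integral_sum[symmetric])
    fix \<beta> assume "\<beta> \<in> B"
    from g[OF this] show "(\<lambda>X. \<integral>\<^sup>+e. g \<beta> X e \<partial>E) \<in> borel_measurable D"
      by (intro E.borel_measurable_nn_integral) (simp only: case_prod_beta')
  qed
  also have "\<dots> = (\<integral>\<^sup>+X. \<integral>\<^sup>+e. (\<Sum>\<beta>\<in>B. g \<beta> X e) \<partial>E \<partial>D)"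
  proof (intro nn_integral_cong nn_integral_sum[symmetric])
    fix X \<beta> assume "X \<in> space D" "\<beta> \<in> B"
    from measurable_compose[OF measurable_Pair1'[OF this(1)] g[OF this(2)]]
    show "g \<beta> X \<in> borel_measurable E" by (simp only: fst_conv snd_conv)
  qed
  finally show ?thesis .
qed

text \<open>The success probability at the actual observation is at most the sum of the success
  probabilities over all \<open>y\<close> in \<open>Y\<close>. After exchanging the sums, every
  \<open>y\<close> contributes at most one by \<open>kernel_disjoint_le_1\<close>, hence
  \<open>card Y\<close> in total.\<close>

lemma prob_joint_law_ge_count:
  assumes P: "{\<omega> \<in> space T. P (fst \<omega>) (fst (snd \<omega>)) (fst (snd (snd \<omega>))) (snd (snd (snd \<omega>)))} \<in> sets T"
    and G: "\<And>\<beta>. \<beta> \<in> B \<Longrightarrow> G \<beta> \<in> sets S" and dis: "disjoint_family_on G B"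
    and sub: "\<And>\<beta> X e b. \<beta> \<in> B \<Longrightarrow> b \<in> space S \<Longrightarrow> \<not> P \<beta> X e b \<Longrightarrow> b \<in> G \<beta>"
    and Y: "finite Y" "AE X in D. AE e in E. \<forall>\<beta>\<in>B. observe J N n h X \<beta> e \<in> Y"
  shows "1 - card Y / card B \<le>
    \<P>((\<beta>, X, e, b) in joint_law J N n h D E B \<kappa>. P \<beta> X e b)"
proof (rule prob_joint_law_ge[OF P])
  let ?g = "\<lambda>\<beta> X e. emeasure (estimate \<beta> X e) (G \<beta>)"
  have "(\<Sum>\<beta>\<in>B. \<integral>\<^sup>+X. \<integral>\<^sup>+e. emeasure (estimate \<beta> X e) {b \<in> space S. \<not> P \<beta> X e b} \<partial>E \<partial>D)
      \<le> (\<Sum>\<beta>\<in>B. \<integral>\<^sup>+X. \<integral>\<^sup>+e. ?g \<beta> X e \<partial>E \<partial>D)"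
    using sub G by (intro sum_mono nn_integral_mono emeasure_mono)
      (auto simp: estimate_prob(2)[OF _ observe_space])
  also have "\<dots> = (\<integral>\<^sup>+X. \<integral>\<^sup>+e. (\<Sum>\<beta>\<in>B. ?g \<beta> X e) \<partial>E \<partial>D)"
  proof (rule sum_nn_integral_swap)
    fix \<beta> assume "\<beta> \<in> B"
    from measurable_compose[OF estimate_measurable[THEN measurable_prob_algebraD]
      measurable_emeasure_subprob_algebra[OF G[OF this]]]
    show "(\<lambda>z. ?g \<beta> (fst z) (snd z)) \<in> borel_measurable (design_space J N n \<Otimes>\<^sub>M obs_space n)" .
  qed
  also have "\<dots> \<le> (\<integral>\<^sup>+X. \<integral>\<^sup>+e. card Y \<partial>E \<partial>D)"
  proof (rule nn_integral_mono_AE, use Y(2) AE_space in eventually_elim, rule nn_integral_mono_AE)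
    fix X assume X: "X \<in> space D" and ae: "AE e in E. \<forall>\<beta>\<in>B. observe J N n h X \<beta> e \<in> Y"
    show "AE e in E. (\<Sum>\<beta>\<in>B. ?g \<beta> X e) \<le> card Y"
      using ae
    proof eventually_elim
      fix e assume e: "\<forall>\<beta>\<in>B. observe J N n h X \<beta> e \<in> Y"
      \<comment> \<open>The intersection ensures that \<kappa> is evaluated only where it is a
        probability measure; by \<open>observe_space\<close> it still contains the actual
        observations.\<close>
      let ?Y = "Y \<inter> space (obs_space n)"
      have "(\<Sum>\<beta>\<in>B. ?g \<beta> X e) \<le> (\<Sum>\<beta>\<in>B. \<Sum>y\<in>?Y. emeasure (\<kappa> (X, y)) (G \<beta>))"
        using e Y(1) observe_space by (intro sum_mono member_le_sum) auto
      also have "\<dots> = (\<Sum>y\<in>?Y. \<Sum>\<beta>\<in>B. emeasure (\<kappa> (X, y)) (G \<beta>))"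
        by (rule sum.swap)
      also have "\<dots> \<le> (\<Sum>y\<in>?Y. 1)"
        using X by (intro sum_mono kernel_disjoint_le_1 G dis) auto
      also have "\<dots> \<le> card Y"
        using Y(1) by (simp add: card_mono)
      finally show "(\<Sum>\<beta>\<in>B. ?g \<beta> X e) \<le> card Y" .
    qed
  qed
  also have "\<dots> = ennreal (card Y / card B * card B)"
    using B D.emeasure_space_1 E.emeasure_space_1 unfolding space_D space_E
    by (simp add: ennreal_of_nat_eq_real_of_nat)
  finally show "(\<Sum>\<beta>\<in>B. \<integral>\<^sup>+X. \<integral>\<^sup>+e. emeasure (estimate \<beta> X e) {b \<in> space S. \<not> P \<beta> X e b} \<partial>E \<partial>D)
      \<le> ennreal (card Y / card B * card B)" .
qed simp

end

section \<open>Gaussian products\<close>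

lemma sets_normal_law [simp, measurable_cong]: "sets (normal_law \<sigma>) = sets borel"
  by (simp add: normal_law_def)

lemma space_normal_law [simp]: "space (normal_law \<sigma>) = UNIV"
  using sets_eq_imp_space_eq[OF sets_normal_law] by simp

lemma prob_space_normal_law: "0 \<le> \<sigma> \<Longrightarrow> prob_space (normal_law \<sigma>)"
  by (auto simp: normal_law_def prob_space_return intro!: prob_space_normal_density)

lemma prob_space_noise_law: "0 \<le> \<sigma> \<Longrightarrow> prob_space (noise_law n \<sigma>)"
  unfolding noise_law_def by (intro prob_space_PiM prob_space_normal_law)

lemma sets_PiM_normal_law: "sets (Pi\<^sub>M I (\<lambda>_. normal_law \<sigma>)) = sets (Pi\<^sub>M I (\<lambda>_. borel))"
  by (simp cong: sets_PiM_cong)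

lemma noise_law_in_prob_algebra: "0 \<le> \<sigma> \<Longrightarrow> noise_law n \<sigma> \<in> space (prob_algebra (obs_space n))"
  using prob_space_noise_law[of \<sigma> n]
  by (simp add: space_prob_algebra noise_law_def obs_space_def sets_PiM_normal_law)

lemma gaussian_design_in_prob_algebra:
  "gaussian_design J N n \<in> space (prob_algebra (design_space J N n))"
  unfolding gaussian_design_def design_space_def
  by (auto simp: space_prob_algebra intro!: prob_space_PiM prob_space_normal_law cong: sets_PiM_cong)

lemma rademacher_design_in_prob_algebra:
  "rademacher_design J N n \<in> space (prob_algebra (design_space J N n))"
  unfolding rademacher_design_def design_space_def
  by (auto simp: space_prob_algebra intro!: prob_space_PiM prob_space.prob_space_distr
      prob_space_measure_pmf cong: sets_PiM_cong)

lemma nn_integral_normal_law: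
  assumes "0 < \<sigma>" "f \<in> borel_measurable borel"
  shows "(\<integral>\<^sup>+x. f x \<partial>normal_law \<sigma>) = (\<integral>\<^sup>+x. ennreal (normal_density 0 \<sigma> x) * f x \<partial>lborel)"
  using assms by (simp add: normal_law_def nn_integral_density)

lemma second_moment_normal_law:
  fixes \<sigma> :: real
  assumes "0 < \<sigma>"
  shows "(\<integral>\<^sup>+x. ennreal (x\<^sup>2) \<partial>normal_law \<sigma>) = ennreal (\<sigma>\<^sup>2)"
proof -
  have "has_bochner_integral lborel (\<lambda>x. normal_density 0 \<sigma> x * x\<^sup>2) (\<sigma>\<^sup>2)"
    using normal_moment_even[OF assms, of 0 1] by simp
  then have "(\<integral>\<^sup>+x. ennreal (normal_density 0 \<sigma> x * x\<^sup>2) \<partial>lborel) = ennreal (\<sigma>\<^sup>2)"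
    by (simp add: has_bochner_integral_iff nn_integral_eq_integral)
  then show ?thesis
    using assms by (simp add: nn_integral_normal_law ennreal_mult)
qed

text \<open>Markov's inequality for the sum of squares, whose mean is
  \<open>card A * \<sigma>\<^sup>2\<close>. The subset \<open>A\<close> allows both the whole noise
  vector and the design entries that belong to a single column.\<close>

lemma normal_squares_tail:
  fixes \<sigma> r :: real
  assumes "0 < \<sigma>" "finite A" "A \<subseteq> I" "0 < r"
  shows "emeasure (Pi\<^sub>M I (\<lambda>_. normal_law \<sigma>))
      {x \<in> space (Pi\<^sub>M I (\<lambda>_. normal_law \<sigma>)). r < (\<Sum>i\<in>A. (x i)\<^sup>2)} \<le> ennreal (card A * \<sigma>\<^sup>2 / r)"
proof -
  let ?M = "Pi\<^sub>M I (\<lambda>_. normal_law \<sigma>)"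
  have [measurable]: "(\<lambda>x. x i) \<in> borel_measurable ?M" if "i \<in> A" for i
    using assms(3) that by (auto intro: measurable_compose[OF measurable_component_singleton])
  have "(\<integral>\<^sup>+x. ennreal (\<Sum>i\<in>A. (x i)\<^sup>2) \<partial>?M) = (\<Sum>i\<in>A. \<integral>\<^sup>+x. ennreal ((x i)\<^sup>2) \<partial>?M)"
    by (subst nn_integral_sum [symmetric]) (auto simp: sum_ennreal)
  also have "\<dots> = (\<Sum>i\<in>A. \<integral>\<^sup>+x. ennreal (x\<^sup>2) \<partial>distr ?M (normal_law \<sigma>) (\<lambda>x. x i))"
    using assms(3) by (intro sum.cong refl nn_integral_distr [symmetric])
      (auto simp: measurable_cong_sets[OF sets_normal_law refl])
  also have "\<dots> = (\<Sum>i\<in>A. ennreal (\<sigma>\<^sup>2))"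
    using assms
    by (intro sum.cong refl) (auto simp: distr_PiM_component[of I "\<lambda>_. normal_law \<sigma>"] prob_space_normal_law second_moment_normal_law)
  also have "\<dots> = ennreal (card A * \<sigma>\<^sup>2)"
    by (simp add: ennreal_mult ennreal_of_nat_eq_real_of_nat)
  finally have int: "(\<integral>\<^sup>+x. ennreal (\<Sum>i\<in>A. (x i)\<^sup>2) \<partial>?M) = ennreal (card A * \<sigma>\<^sup>2)" .
  \<comment> \<open>The factor \<open>1 / r\<close> normalises the threshold to 1, the form in which
    Markov's inequality is applied.\<close>
  have "emeasure ?M {x \<in> space ?M. r < (\<Sum>i\<in>A. (x i)\<^sup>2)}
      \<le> emeasure ?M {x \<in> space ?M. 1 \<le> ennreal (1 / r) * ennreal (\<Sum>i\<in>A. (x i)\<^sup>2)}"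
    using assms(4)
    by (intro emeasure_mono) (auto simp: sum_nonneg simp flip: ennreal_mult ennreal_1 intro!: ennreal_leI)
  also have "\<dots> \<le> ennreal (1 / r) * (\<integral>\<^sup>+x. ennreal (\<Sum>i\<in>A. (x i)\<^sup>2) * indicator (space ?M) x \<partial>?M)"
    using nn_integral_Markov_inequality[of "\<lambda>x. ennreal (\<Sum>i\<in>A. (x i)\<^sup>2)" "space ?M" ?M "ennreal (1 / r)"]
    by simp
  also have "(\<integral>\<^sup>+x. ennreal (\<Sum>i\<in>A. (x i)\<^sup>2) * indicator (space ?M) x \<partial>?M) = ennreal (card A * \<sigma>\<^sup>2)"
    unfolding int[symmetric] by (intro nn_integral_cong) simp
  finally show ?thesis
    using assms(4) by (simp flip: ennreal_mult)
qed

text \<open>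
  The density of a shifted Gaussian is at most its maximum, which is \<open>exp (y\<^sup>2 / (2 * \<sigma>\<^sup>2))\<close> times
  the centred density at \<open>y\<close>; the resulting bound does not depend on the shift.
\<close>

lemma nn_integral_normal_law_shift_le:
  assumes \<sigma>: "0 < \<sigma>" and [measurable]: "f \<in> borel_measurable borel"
  shows "(\<integral>\<^sup>+x. f (a + x) \<partial>normal_law \<sigma>) \<le> (\<integral>\<^sup>+y. f y * ennreal (exp (y\<^sup>2 / (2 * \<sigma>\<^sup>2))) \<partial>normal_law \<sigma>)"
proof -
  let ?c = "1 / sqrt (2 * pi * \<sigma>\<^sup>2)"
  have "(\<integral>\<^sup>+x. f (a + x) \<partial>normal_law \<sigma>) \<le> (\<integral>\<^sup>+x. ennreal ?c * f (a + x) \<partial>lborel)"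
    using \<sigma> by (subst nn_integral_normal_law)
      (auto intro!: nn_integral_mono mult_right_mono ennreal_leI divide_right_mono simp: normal_density_def)
  \<comment> \<open>Translation invariance of Lebesgue measure, as the affine substitution with
    slope 1.\<close>
  also have "\<dots> = (\<integral>\<^sup>+x. ennreal ?c * f x \<partial>lborel)"
    using nn_integral_real_affine[of "\<lambda>x. ennreal ?c * f x" 1 a] by simp
  also have "\<dots> = (\<integral>\<^sup>+x. ennreal (normal_density 0 \<sigma> x) * (f x * ennreal (exp (x\<^sup>2 / (2 * \<sigma>\<^sup>2)))) \<partial>lborel)"
  proof (rule nn_integral_cong)
    fix x
    have "normal_density 0 \<sigma> x * exp (x\<^sup>2 / (2 * \<sigma>\<^sup>2)) = ?c"
      by (simp add: normal_density_def flip: exp_add)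
    then have "ennreal ?c = ennreal (normal_density 0 \<sigma> x) * ennreal (exp (x\<^sup>2 / (2 * \<sigma>\<^sup>2)))"
      by (simp flip: ennreal_mult)
    then show "ennreal ?c * f x =
        ennreal (normal_density 0 \<sigma> x) * (f x * ennreal (exp (x\<^sup>2 / (2 * \<sigma>\<^sup>2))))"
      by (simp only: mult_ac)
  qed
  also have "\<dots> = (\<integral>\<^sup>+y. f y * ennreal (exp (y\<^sup>2 / (2 * \<sigma>\<^sup>2))) \<partial>normal_law \<sigma>)"
    using \<sigma> by (subst nn_integral_normal_law) auto
  finally show ?thesis .
qed

text \<open>Induction over the coordinates with Fubini: the one-dimensional bound handles the new
  coordinate, the induction hypothesis the others, and the exponential weights multiply.\<close>

lemma nn_integral_PiM_normal_law_shift_le: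
  fixes a :: "'i \<Rightarrow> real"
  assumes \<sigma>: "0 < \<sigma>" and "finite I" and "f \<in> borel_measurable (Pi\<^sub>M I (\<lambda>_. borel))"
  shows "(\<integral>\<^sup>+x. f (\<lambda>i\<in>I. a i + x i) \<partial>Pi\<^sub>M I (\<lambda>_. normal_law \<sigma>))
    \<le> (\<integral>\<^sup>+y. f y * ennreal (exp ((\<Sum>i\<in>I. (y i)\<^sup>2) / (2 * \<sigma>\<^sup>2))) \<partial>Pi\<^sub>M I (\<lambda>_. normal_law \<sigma>))"
  using assms(2,3)
proof (induction I arbitrary: f)
  case empty
  then show ?case by (simp add: PiM_empty nn_integral_count_space_finite restrict_def)
next
  case (insert i I)
  note [measurable] = insert.prems
  interpret product_sigma_finite "\<lambda>_::'i. normal_law \<sigma>"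
    using \<sigma> by (intro product_sigma_finite.intro prob_space_imp_sigma_finite prob_space_normal_law) simp
  let ?P = "\<lambda>I. Pi\<^sub>M I (\<lambda>_::'i. normal_law \<sigma>)"
  let ?w = "\<lambda>y::real. ennreal (exp (y\<^sup>2 / (2 * \<sigma>\<^sup>2)))"
  let ?W = "\<lambda>y. ennreal (exp ((\<Sum>k\<in>I. (y k)\<^sup>2) / (2 * \<sigma>\<^sup>2)))"
  note [measurable_cong] = sets_PiM_normal_law
  have upd [measurable]: "(\<lambda>z. f ((fst z)(i := snd z))) \<in> borel_measurable (Pi\<^sub>M I (\<lambda>_. borel) \<Otimes>\<^sub>M borel)"
    using measurable_compose[OF measurable_add_dim insert.prems] by (simp add: case_prod_beta')
  \<comment> \<open>The new coordinate is integrated out together with its weight, leaving a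
    function of the old coordinates to which the induction hypothesis applies.\<close>
  define g where "g u = (\<integral>\<^sup>+y. f (u(i := y)) * ?w y \<partial>normal_law \<sigma>)" for u
  have g [measurable]: "g \<in> borel_measurable (Pi\<^sub>M I (\<lambda>_. borel))"
    unfolding g_def
    by (rule M.borel_measurable_nn_integral) (simp add: case_prod_beta')
  have "(\<integral>\<^sup>+x. f (\<lambda>k\<in>insert i I. a k + x k) \<partial>?P (insert i I))
      = (\<integral>\<^sup>+x. \<integral>\<^sup>+y. f (\<lambda>k\<in>insert i I. a k + (x(i := y)) k) \<partial>normal_law \<sigma> \<partial>?P I)"
    using insert.hyps by (intro product_nn_integral_insert) measurable
  also have "\<dots> = (\<integral>\<^sup>+x. \<integral>\<^sup>+y. f ((\<lambda>k\<in>I. a k + x k)(i := a i + y)) \<partial>normal_law \<sigma> \<partial>?P I)"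
    using insert.hyps by (intro nn_integral_cong arg_cong[of _ _ f]) auto
  \<comment> \<open>The one-dimensional bound in the new coordinate, with the old coordinates frozen
    at their shifted values.\<close>
  also have "\<dots> \<le> (\<integral>\<^sup>+x. g (\<lambda>k\<in>I. a k + x k) \<partial>?P I)"
    unfolding g_def
  proof (rule nn_integral_mono)
    fix x assume "x \<in> space (?P I)"
    have "(\<lambda>k\<in>I. a k + x k) \<in> space (Pi\<^sub>M I (\<lambda>_. borel))" by (simp add: space_PiM)
    from measurable_compose[OF measurable_Pair1'[OF this] upd]
    have "(\<lambda>y. f ((\<lambda>k\<in>I. a k + x k)(i := y))) \<in> borel_measurable borel" by simp
    from nn_integral_normal_law_shift_le[OF \<sigma> this]
    show "(\<integral>\<^sup>+y. f ((\<lambda>k\<in>I. a k + x k)(i := a i + y)) \<partial>normal_law \<sigma>)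
        \<le> (\<integral>\<^sup>+y. f ((\<lambda>k\<in>I. a k + x k)(i := y)) * ?w y \<partial>normal_law \<sigma>)" .
  qed
  also have "\<dots> \<le> (\<integral>\<^sup>+x. g x * ?W x \<partial>?P I)"
    by (rule insert.IH[OF g])
  also have "\<dots> = (\<integral>\<^sup>+x. \<integral>\<^sup>+y. f (x(i := y)) * ennreal (exp ((\<Sum>k\<in>insert i I. ((x(i := y)) k)\<^sup>2) / (2 * \<sigma>\<^sup>2)))
      \<partial>normal_law \<sigma> \<partial>?P I)"
  proof (rule nn_integral_cong)
    fix x assume x: "x \<in> space (?P I)"
    then have "x \<in> space (Pi\<^sub>M I (\<lambda>_. borel))" by (simp add: space_PiM)
    from measurable_compose[OF measurable_Pair1'[OF this] upd]
    have [measurable]: "(\<lambda>y. f (x(i := y))) \<in> borel_measurable borel" by simp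
    have "g x * ?W x = (\<integral>\<^sup>+y. f (x(i := y)) * ?w y * ?W x \<partial>normal_law \<sigma>)"
      unfolding g_def by (rule nn_integral_multc [symmetric]) measurable
    also have "\<dots> = (\<integral>\<^sup>+y. f (x(i := y)) * ennreal (exp ((\<Sum>k\<in>insert i I. ((x(i := y)) k)\<^sup>2) / (2 * \<sigma>\<^sup>2)))
        \<partial>normal_law \<sigma>)"
    proof (rule nn_integral_cong)
      fix y
      have "(\<Sum>k\<in>insert i I. ((x(i := y)) k)\<^sup>2) = y\<^sup>2 + (\<Sum>k\<in>I. (x k)\<^sup>2)"
        using insert.hyps by (auto intro!: sum.cong)
      then show "f (x(i := y)) * ?w y * ?W x =
          f (x(i := y)) * ennreal (exp ((\<Sum>k\<in>insert i I. ((x(i := y)) k)\<^sup>2) / (2 * \<sigma>\<^sup>2)))"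
        by (simp add: add_divide_distrib exp_add ennreal_mult mult.assoc)
    qed
    finally show "g x * ?W x = \<dots>" .
  qed
  also have "\<dots> = (\<integral>\<^sup>+y. f y * ennreal (exp ((\<Sum>k\<in>insert i I. (y k)\<^sup>2) / (2 * \<sigma>\<^sup>2))) \<partial>?P (insert i I))"
    using insert.hyps by (intro product_nn_integral_insert [symmetric]) measurable
  finally show ?case .
qed

section \<open>Signals supported on one column\<close>

lemma signal_eqI:
  assumes "f \<in> space (signal_space J N)" "g \<in> space (signal_space J N)"
    "\<And>p. p \<in> grid J N \<Longrightarrow> f p = g p"
  shows "f = g"
  using assms by (intro PiE_ext[of f "grid J N" "\<lambda>_. UNIV" g]) (simp_all add: space_signal_space)

definition column_signal :: "nat \<Rightarrow> nat \<Rightarrow> real \<Rightarrow> nat \<Rightarrow> signal" where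
  "column_signal J N a j = (\<lambda>p\<in>grid J N. if snd p = j then a else 0)"

definition column_signals :: "nat \<Rightarrow> nat \<Rightarrow> real \<Rightarrow> signal set" where
  "column_signals J N a = column_signal J N a ` {1..N}"

lemma column_signals_subset: "column_signals J N a \<subseteq> space (signal_space J N)"
  by (auto simp: column_signals_def column_signal_def space_signal_space)

lemma finite_column_signals: "finite (column_signals J N a)"
  by (simp add: column_signals_def)

lemma column_signals_nonempty: "1 \<le> N \<Longrightarrow> column_signals J N a \<noteq> {}"
  by (simp add: column_signals_def)

lemma card_column_signals:
  assumes "1 \<le> J" "a \<noteq> 0"
  shows "card (column_signals J N a) = N"
proof -
  have "inj_on (column_signal J N a) {1..N}"
  proof (rule inj_onI)
    fix j k assume jk: "j \<in> {1..N}" "k \<in> {1..N}" "column_signal J N a j = column_signal J N a k"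
    \<comment> \<open>The entry in row 1 tells the columns apart; the row exists because
      \<open>1 \<le> J\<close>, and the entry is visible because \<open>a\<close> is
      nonzero.\<close>
    then have "column_signal J N a k (1, j) = a"
      using assms by (simp flip: jk(3)) (simp add: column_signal_def grid_def)
    then show "j = k"
      using assms jk by (simp add: column_signal_def grid_def split: if_splits)
  qed
  then show ?thesis by (simp add: column_signals_def card_image)
qed

lemma support_column_signal:
  assumes "j \<in> {1..N}" "a \<noteq> 0"
  shows "support J N (column_signal J N a j) = {1..J} \<times> {j}"
  using assms by (auto simp: support_def column_signal_def grid_def split: if_splits)

lemma signal_ensemble_column_signals:
  assumes "1 \<le> N" "a \<noteq> 0"
  shows "signal_ensemble J N 1 (column_signals J N a)"
  unfolding signal_ensemble_def
proof (intro conjI exI[of _ "{a}"])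
  show "column_signals J N a \<subseteq> block_signals J N 1 {a}"
  proof
    fix \<beta> assume "\<beta> \<in> column_signals J N a"
    then obtain j where j: "j \<in> {1..N}" and \<beta>: "\<beta> = column_signal J N a j"
      by (auto simp: column_signals_def)
    have "{1..J} \<times> {j} \<in> block_model J N 1"
      using j by (auto simp: block_model_def intro!: exI[of _ "{j}"])
    moreover have "\<beta> ` ({1..J} \<times> {j}) \<subseteq> {a}"
      using j by (auto simp: \<beta> column_signal_def grid_def)
    moreover have "\<beta> \<in> grid J N \<rightarrow>\<^sub>E UNIV"
      by (simp add: \<beta> column_signal_def)
    ultimately show "\<beta> \<in> block_signals J N 1 {a}"
      using support_column_signal[OF j assms(2), of J]
      by (simp only: block_signals_def \<beta> mem_Collect_eq simp_thms)
  qed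
qed (use column_signals_nonempty[OF assms(1)] in \<open>simp_all add: finite_column_signals\<close>)

lemma sum_grid_column_signal:
  assumes "j \<in> {1..N}"
  shows "(\<Sum>p\<in>grid J N. f p * column_signal J N a j p) = a * (\<Sum>r = 1..J. f (r, j))"
proof -
  have "(\<Sum>p\<in>grid J N. f p * column_signal J N a j p) = (\<Sum>p\<in>grid J N. if snd p = j then f p * a else 0)"
    by (intro sum.cong) (auto simp: column_signal_def)
  also have "\<dots> = (\<Sum>r = 1..J. \<Sum>k = 1..N. if k = j then f (r, k) * a else 0)"
    by (simp only: grid_def sum.cartesian_product case_prod_beta' prod.collapse)
  also have "\<dots> = (\<Sum>r = 1..J. f (r, j) * a)"
    using assms by (intro sum.cong refl) simp
  also have "\<dots> = a * (\<Sum>r = 1..J. f (r, j))"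
    by (simp add: sum_distrib_left mult.commute)
  finally show ?thesis .
qed

text \<open>
  The map \<open>f\<close> is the identity for exact recovery and the normalisation for recovery of the direction.
\<close>

definition near :: "nat \<Rightarrow> nat \<Rightarrow> (signal \<Rightarrow> signal) \<Rightarrow> real \<Rightarrow> real \<Rightarrow> signal \<Rightarrow> signal set" where
  "near J N f c r \<beta> = {b \<in> space (signal_space J N). \<forall>p\<in>grid J N. \<bar>f b p - c * \<beta> p\<bar> < r}"

lemma sets_near:
  assumes [measurable]: "\<And>p. p \<in> grid J N \<Longrightarrow> (\<lambda>b. f b p) \<in> borel_measurable (signal_space J N)"
  shows "near J N f c r \<beta> \<in> sets (signal_space J N)"
  unfolding near_def by measurable

text \<open>Two distinct column signals differ by exactly \<open>a\<close> at some grid entry. After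
  scaling by \<open>c\<close> the gap there is at least \<open>2 * r\<close>, so no value lies
  within \<open>r\<close> of both.\<close>

lemma disjoint_near:
  assumes "2 * r \<le> c * a" "0 < c" "0 < a"
  shows "disjoint_family_on (near J N f c r) (column_signals J N a)"
  unfolding disjoint_family_on_def
proof (intro ballI impI)
  fix \<beta> \<beta>' assume \<beta>: "\<beta> \<in> column_signals J N a" "\<beta>' \<in> column_signals J N a" and ne: "\<beta> \<noteq> \<beta>'"
  have "\<exists>p\<in>grid J N. \<beta> p \<noteq> \<beta>' p"
    using signal_eqI[of \<beta> J N \<beta>'] \<beta> ne column_signals_subset[of J N a] by blast
  then obtain p where p: "p \<in> grid J N" "\<beta> p \<noteq> \<beta>' p" by blast
  have "\<bar>\<beta> p - \<beta>' p\<bar> = a"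
    using \<beta> p assms(3) by (auto simp: column_signals_def column_signal_def split: if_splits)
  then have "\<bar>c * \<beta> p - c * \<beta>' p\<bar> = c * a"
    using assms(2) by (simp add: abs_mult flip: right_diff_distrib)
  then have "\<not> (\<bar>f b p - c * \<beta> p\<bar> < r \<and> \<bar>f b p - c * \<beta>' p\<bar> < r)" for b
    using assms(1) by linarith
  then show "near J N f c r \<beta> \<inter> near J N f c r \<beta>' = {}"
    using p(1) by (auto simp: near_def)
qed

lemma abs_le_L2_set: "finite A \<Longrightarrow> i \<in> A \<Longrightarrow> \<bar>f i\<bar> \<le> L2_set f A"
  using member_le_L2_set[of A i "\<lambda>i. \<bar>f i\<bar>"] by (simp add: L2_set_def)

lemma L2_set_column_signal:
  assumes "j \<in> {1..N}"
  shows "L2_set (column_signal J N a j) (grid J N) = sqrt J * \<bar>a\<bar>"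
proof -
  \<comment> \<open>Writing the square as a product makes \<open>sum_grid_column_signal\<close>
    applicable with the signal itself in the role of \<open>f\<close>.\<close>
  have "(\<Sum>p\<in>grid J N. (column_signal J N a j p)\<^sup>2) =
      (\<Sum>p\<in>grid J N. column_signal J N a j p * column_signal J N a j p)"
    by (simp add: power2_eq_square)
  also have "\<dots> = J * a\<^sup>2"
    unfolding sum_grid_column_signal[OF assms] using assms
    by (simp add: column_signal_def grid_def power2_eq_square)
  finally show ?thesis
    by (simp add: L2_set_def real_sqrt_mult)
qed

lemma measurable_L2_set:
  assumes "\<And>i. i \<in> A \<Longrightarrow> (\<lambda>x. f x i) \<in> borel_measurable M"
  shows "(\<lambda>x. L2_set (f x) A) \<in> borel_measurable M"
  unfolding L2_set_def using assms by measurable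

text \<open>Signals are extensional, so inequality is witnessed at one of finitely many grid
  entries, and each of these comparisons is measurable.\<close>

lemma sets_signal_neq:
  assumes [measurable]: "f \<in> M \<rightarrow>\<^sub>M signal_space J N" "g \<in> M \<rightarrow>\<^sub>M signal_space J N"
  shows "{x \<in> space M. f x \<noteq> g x} \<in> sets M"
proof -
  have "{x \<in> space M. f x \<noteq> g x} = {x \<in> space M. \<exists>p\<in>grid J N. f x p \<noteq> g x p}"
  proof -
    have "f x = g x" if "x \<in> space M" "\<And>p. p \<in> grid J N \<Longrightarrow> f x p = g x p" for x
      using that by (intro signal_eqI[of _ J N] measurable_space[OF assms(1)] measurable_space[OF assms(2)])
    then show ?thesis by (intro Collect_cong) metis
  qed
  also have "\<dots> \<in> sets M"
  proof -
    have [measurable]: "(\<lambda>x. f x p) \<in> borel_measurable M" "(\<lambda>x. g x p) \<in> borel_measurable M"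
      if "p \<in> grid J N" for p
      using assms measurable_signal_component[OF that] by (auto intro: measurable_compose)
    show ?thesis by measurable
  qed
  finally show ?thesis .
qed

lemma sensing_column_signals:
  assumes "D \<in> space (prob_algebra (design_space J N n))" "E \<in> space (prob_algebra (obs_space n))"
    "h \<in> borel_measurable borel" "1 \<le> N" "\<kappa> \<in> procedures J N n"
  shows "sensing J N n h D E (column_signals J N a) \<kappa>"
  using assms column_signals_subset[of J N a]
  by unfold_locales (auto simp: finite_column_signals column_signals_nonempty)

lemma measurable_sign_with [measurable]: "sign_with c \<in> borel_measurable borel"
  unfolding sign_with_def [abs_def] by measurable

text \<open>The rate 1610 comes from the Gaussian noise case; this lemma lets the same size
  condition on \<open>N\<close> serve the counting cases. The bound \<open>3 ^ n\<close> covers both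
  sign patterns and sums of two random signs.\<close>

lemma one_minus_count_ge:
  fixes c n N :: nat
  assumes "c \<le> 3 ^ n" "exp (1610 * real n) \<le> N / 2"
  shows "1 / 2 \<le> 1 - real c / real N"
proof -
  have "(3::real) \<le> exp 1610" using exp_ge_add_one_self[of 1610] by simp
  then have "(3::real) ^ n \<le> exp 1610 ^ n" by (intro power_mono) auto
  also have "\<dots> = exp (1610 * real n)" by (simp add: mult.commute flip: exp_of_nat_mult)
  finally have "real (3 ^ n) \<le> N / 2" using assms(2) by simp
  moreover have "real c \<le> real (3 ^ n)" using assms(1) by (rule of_nat_mono)
  ultimately have "real c \<le> N / 2" by linarith
  moreover have "0 < real N" using assms(2) exp_gt_zero[of "1610 * real n"] by linarith
  ultimately show ?thesis by (simp add: field_simps)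
qed

section \<open>One-bit sensing: exact recovery and recovery of the direction\<close>

lemma one_bit_observe:
  assumes "c \<in> {-1, 1}"
  shows "observe J N n (sign_with c) X \<beta> e \<in> {1..n} \<rightarrow>\<^sub>E {-1, 1}"
  using assms by (auto simp: observe_def sign_with_def sgn_if)

lemma one_bit_exact:
  assumes "1 \<le> J" "0 \<le> \<sigma>" "c \<in> {-1, 1}" "exp (1610 * real n) \<le> N / 2" "\<kappa> \<in> procedures J N n"
  shows "1 / 2 \<le> \<P>((\<beta>, X, e, b) in one_bit_law J N n \<sigma> c (column_signals J N 1) \<kappa>. b \<noteq> \<beta>)"
proof -
  have N: "1 \<le> N" using assms(4) exp_gt_zero[of "1610 * real n"] by (cases N) auto
  interpret sensing J N n "sign_with c" "gaussian_design J N n" "noise_law n \<sigma>" "column_signals J N 1" \<kappa>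
    by (intro sensing_column_signals gaussian_design_in_prob_algebra noise_law_in_prob_algebra
        measurable_sign_with assms N)
  let ?Y = "{1..n} \<rightarrow>\<^sub>E {-1, 1::real}"
  have "1 / 2 \<le> 1 - real (card ?Y) / real (card (column_signals J N 1))"
    unfolding card_column_signals[OF assms(1) one_neq_zero]
    using assms(4) by (intro one_minus_count_ge) (auto simp: card_PiE power_mono)
  also have "\<dots> \<le> \<P>((\<beta>, X, e, b) in one_bit_law J N n \<sigma> c (column_signals J N 1) \<kappa>. b \<noteq> \<beta>)"
    unfolding one_bit_law_def
  \<comment> \<open>Exact recovery places \<open>b\<close> in the sup-norm ball of radius
    \<open>1 / 2\<close> around \<beta>; these balls are measurable, and disjoint because the
    amplitude is 1.\<close>
  proof (rule prob_joint_law_ge_count[where G = "near J N (\<lambda>b. b) 1 (1 / 2)"])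
    show "{\<omega> \<in> space T. snd (snd (snd \<omega>)) \<noteq> fst \<omega>} \<in> sets T"
      by (rule sets_signal_neq) measurable
    show "near J N (\<lambda>b. b) 1 (1 / 2) \<beta> \<in> sets S" for \<beta>
      by (rule sets_near) (rule measurable_signal_component)
    show "disjoint_family_on (near J N (\<lambda>b. b) 1 (1 / 2)) (column_signals J N 1)"
      by (rule disjoint_near) auto
    show "b \<in> near J N (\<lambda>b. b) 1 (1 / 2) \<beta>"
      if "b \<in> space S" "\<not> b \<noteq> \<beta>" for \<beta> b
      using that by (auto simp: near_def)
    show "AE X in gaussian_design J N n. AE e in noise_law n \<sigma>. \<forall>\<beta>\<in>column_signals J N 1.
        observe J N n (sign_with c) X \<beta> e \<in> ?Y"
      using one_bit_observe[OF assms(3)] by simp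
  qed (auto intro: finite_PiE)
  finally show ?thesis .
qed

text \<open>A column signal of amplitude 1 has norm \<open>sqrt J\<close>, so normalised signals are
  separated by \<open>1 / sqrt J\<close> at some entry, and the threshold is half of that. An error
  below the threshold in the norm is below it at every entry. As division by 0 yields 0, a zero
  estimate is normalised to the zero signal.\<close>

lemma one_bit_direction:
  assumes "1 \<le> J" "0 \<le> \<sigma>" "c \<in> {-1, 1}" "exp (1610 * real n) \<le> N / 2" "\<kappa> \<in> procedures J N n"
  shows "1 / 2 \<le> \<P>((\<beta>, X, e, b) in one_bit_law J N n \<sigma> c (column_signals J N 1) \<kappa>.
    L2_set (\<lambda>p. b p / L2_set b (grid J N) - \<beta> p / L2_set \<beta> (grid J N)) (grid J N) \<ge> 1 / (2 * sqrt J))"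
proof -
  let ?P = "\<lambda>\<beta> b. L2_set (\<lambda>p. b p / L2_set b (grid J N) - \<beta> p / L2_set \<beta> (grid J N)) (grid J N) \<ge> 1 / (2 * sqrt J)"
  have N: "1 \<le> N" using assms(4) exp_gt_zero[of "1610 * real n"] by (cases N) auto
  interpret sensing J N n "sign_with c" "gaussian_design J N n" "noise_law n \<sigma>" "column_signals J N 1" \<kappa>
    by (intro sensing_column_signals gaussian_design_in_prob_algebra noise_law_in_prob_algebra
        measurable_sign_with assms N)
  let ?Y = "{1..n} \<rightarrow>\<^sub>E {-1, 1::real}"
  let ?near = "near J N (\<lambda>b p. b p / L2_set b (grid J N)) (1 / sqrt J) (1 / (2 * sqrt J))"
  have "1 / 2 \<le> 1 - real (card ?Y) / real (card (column_signals J N 1))"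
    unfolding card_column_signals[OF assms(1) one_neq_zero]
    using assms(4) by (intro one_minus_count_ge) (auto simp: card_PiE power_mono)
  also have "\<dots> \<le> \<P>((\<beta>, X, e, b) in one_bit_law J N n \<sigma> c (column_signals J N 1) \<kappa>. ?P \<beta> b)"
    unfolding one_bit_law_def
  proof (rule prob_joint_law_ge_count[where G = ?near])
    have [measurable]: "(\<lambda>\<omega>. fst \<omega> p) \<in> borel_measurable T" "(\<lambda>\<omega>. snd (snd (snd \<omega>)) p) \<in> borel_measurable T"
      if "p \<in> grid J N" for p
      by (auto intro!: measurable_compose[OF _ measurable_signal_component[OF that]])
    show "{\<omega> \<in> space T. ?P (fst \<omega>) (snd (snd (snd \<omega>)))} \<in> sets T"
      unfolding L2_set_def by measurable
    show "?near \<beta> \<in> sets S" for \<beta>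
      by (intro sets_near borel_measurable_divide measurable_L2_set measurable_signal_component)
    show "disjoint_family_on ?near (column_signals J N 1)"
      using assms(1) by (intro disjoint_near) auto
    show "b \<in> ?near \<beta>"
      if \<beta>: "\<beta> \<in> column_signals J N 1" and b: "b \<in> space S" and P: "\<not> ?P \<beta> b"
      for \<beta> b
    proof -
      have L2: "L2_set \<beta> (grid J N) = sqrt J"
        using \<beta> by (auto simp: column_signals_def L2_set_column_signal)
      have "\<bar>b p / L2_set b (grid J N) - 1 / sqrt J * \<beta> p\<bar> < 1 / (2 * sqrt J)" if "p \<in> grid J N" for p
        using abs_le_L2_set[OF finite_grid that, of "\<lambda>p. b p / L2_set b (grid J N) - \<beta> p / L2_set \<beta> (grid J N)"] P
        by (simp add: L2)
      then show ?thesis using b by (simp add: near_def)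
    qed
    show "AE X in gaussian_design J N n. AE e in noise_law n \<sigma>. \<forall>\<beta>\<in>column_signals J N 1.
        observe J N n (sign_with c) X \<beta> e \<in> ?Y"
      using one_bit_observe[OF assms(3)] by simp
  qed (auto intro: finite_PiE)
  finally show ?thesis .
qed

section \<open>Noiseless sensing with random signs\<close>

lemma AE_rademacher_design:
  "AE X in rademacher_design J N n. \<forall>q\<in>{1..n} \<times> grid J N. X q \<in> {1 / sqrt n, - 1 / sqrt n}"
proof -
  let ?R = "distr (measure_pmf (pmf_of_set {1 / sqrt n, - 1 / sqrt n})) borel (\<lambda>x. x)"
  have R: "prob_space ?R"
    by (intro prob_space.prob_space_distr prob_space_measure_pmf) auto
  have "AE x in ?R. x \<in> {1 / sqrt n, - 1 / sqrt n}"
    by (subst AE_distr_iff) (auto simp: AE_measure_pmf_iff)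
  then have "AE X in rademacher_design J N n. X q \<in> {1 / sqrt n, - 1 / sqrt n}"
    if "q \<in> {1..n} \<times> grid J N" for q
    unfolding rademacher_design_def using that R by (intro AE_PiM_component) auto
  then show ?thesis
    by (intro AE_finite_allI) auto
qed

lemma AE_normal_law_0: "AE x in normal_law 0. x = 0"
  unfolding normal_law_def by (subst if_P) (auto simp: AE_return)

lemma AE_noise_law_0: "AE e in noise_law n 0. \<forall>i\<in>{1..n}. e i = 0"
proof (intro AE_finite_allI finite_atLeastAtMost)
  fix i assume "i \<in> {1..n}"
  then show "AE e in noise_law n 0. e i = 0"
    unfolding noise_law_def
    by (intro AE_PiM_component[where P = "\<lambda>x. x = 0"] prob_space_normal_law)
      (auto simp: AE_normal_law_0)
qed

lemma noiseless_exact: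
  assumes "exp (1610 * real n) \<le> N / 2" "\<kappa> \<in> procedures 2 N n"
  shows "1 / 2 \<le> \<P>((\<beta>, X, e, b) in noiseless_law 2 N n (column_signals 2 N 1) \<kappa>. \<beta> \<noteq> b)"
proof -
  have N: "1 \<le> N" using assms(1) exp_gt_zero[of "1610 * real n"] by (cases N) auto
  interpret sensing 2 N n "\<lambda>x. x" "rademacher_design 2 N n" "noise_law n 0" "column_signals 2 N 1" \<kappa>
    by (intro sensing_column_signals rademacher_design_in_prob_algebra noise_law_in_prob_algebra
        measurable_ident assms N) auto
  \<comment> \<open>Two rows add two entries of size \<open>1 / sqrt n\<close> with signs, which
    leaves three possible values per observation.\<close>
  let ?V = "{2 / sqrt n, 0, - 2 / sqrt n}"
  let ?Y = "{1..n} \<rightarrow>\<^sub>E ?V"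
  \<comment> \<open>Only an upper bound is claimed: for \<open>n = 0\<close> division by 0 makes the
    three values coincide.\<close>
  have "card ?V \<le> 3" using card_insert_le_m1 by (simp add: card_insert_if)
  then have "1 / 2 \<le> 1 - real (card ?Y) / real (card (column_signals 2 N 1))"
    unfolding card_column_signals[OF one_le_numeral one_neq_zero]
    using assms(1) by (intro one_minus_count_ge) (auto simp only: card_PiE finite_atLeastAtMost
      prod_constant card_atLeastAtMost diff_Suc_1 intro!: power_mono)
  also have "\<dots> \<le> \<P>((\<beta>, X, e, b) in noiseless_law 2 N n (column_signals 2 N 1) \<kappa>. \<beta> \<noteq> b)"
    unfolding noiseless_law_def
  proof (rule prob_joint_law_ge_count[where G = "near 2 N (\<lambda>b. b) 1 (1 / 2)"])
    show "{\<omega> \<in> space T. fst \<omega> \<noteq> snd (snd (snd \<omega>))} \<in> sets T"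
      by (rule sets_signal_neq) measurable
    show "near 2 N (\<lambda>b. b) 1 (1 / 2) \<beta> \<in> sets S" for \<beta>
      by (rule sets_near) (rule measurable_signal_component)
    show "disjoint_family_on (near 2 N (\<lambda>b. b) 1 (1 / 2)) (column_signals 2 N 1)"
      by (rule disjoint_near) auto
    show "b \<in> near 2 N (\<lambda>b. b) 1 (1 / 2) \<beta>"
      if "b \<in> space S" "\<not> \<beta> \<noteq> b" for \<beta> b
      using that by (auto simp: near_def)
    show "AE X in rademacher_design 2 N n. AE e in noise_law n 0. \<forall>\<beta>\<in>column_signals 2 N 1.
        observe 2 N n (\<lambda>x. x) X \<beta> e \<in> ?Y"
      using AE_rademacher_design
    proof eventually_elim
      fix X assume X: "\<forall>q\<in>{1..n} \<times> grid 2 N. X q \<in> {1 / sqrt n, - 1 / sqrt n}"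
      show "AE e in noise_law n 0. \<forall>\<beta>\<in>column_signals 2 N 1. observe 2 N n (\<lambda>x. x) X \<beta> e \<in> ?Y"
        using AE_noise_law_0
      proof eventually_elim
        fix e :: "nat \<Rightarrow> real" assume e: "\<forall>i\<in>{1..n}. e i = 0"
        have "X (i, 1, j) + X (i, 2, j) \<in> ?V" if "i \<in> {1..n}" "j \<in> {1..N}" for i j
        proof -
          have "(i, 1, j) \<in> {1..n} \<times> grid 2 N" "(i, 2, j) \<in> {1..n} \<times> grid 2 N"
            using that by (auto simp: grid_def)
          with X have "X (i, 1, j) \<in> {1 / sqrt n, - 1 / sqrt n}" "X (i, 2, j) \<in> {1 / sqrt n, - 1 / sqrt n}"
            by blast+
          then show ?thesis by auto
        qed
        then show "\<forall>\<beta>\<in>column_signals 2 N 1. observe 2 N n (\<lambda>x. x) X \<beta> e \<in> ?Y"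
          using e by (auto simp: column_signals_def observe_def sum_grid_column_signal numeral_2_eq_2)
      qed
    qed
  qed (auto intro: finite_PiE)
  finally show ?thesis .
qed


section \<open>Sensing with Gaussian noise\<close>

lemma observe_column_signal:
  assumes "j \<in> {1..N}"
  shows "observe J N n h X (column_signal J N a j) e =
    (\<lambda>i\<in>{1..n}. h (a * (\<Sum>r = 1..J. X (i, r, j)) + e i))"
  unfolding observe_def sum_grid_column_signal[OF assms] ..

text \<open>The constants of the next two lemmas are \<open>3220 = 2 * (2 * 40 * 20 + 10)\<close> and \<open>1610 = 3220 / 2\<close>.\<close>

lemma observe_squares_le:
  assumes j: "j \<in> {1..N}" and X: "(\<Sum>q\<in>{1..n} \<times> {1..2::nat} \<times> {j}. (X q)\<^sup>2) \<le> 20"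
    and e: "(\<Sum>i = 1..n. (e i)\<^sup>2) \<le> 10 * v" and a: "a\<^sup>2 = 40 * v"
  shows "(\<Sum>i = 1..n. (observe 2 N n (\<lambda>x. x) X (column_signal 2 N a j) e i)\<^sup>2) \<le> 3220 * v"
proof -
  have v: "0 \<le> v" using a zero_le_power2[of a] by linarith
  \<comment> \<open>Applied twice, first to split signal from noise and then to split the two rows;
    hence the factor 4 at \<open>a\<^sup>2\<close> and the factor 2 at the noise.\<close>
  have sq: "(x + y)\<^sup>2 \<le> 2 * x\<^sup>2 + 2 * y\<^sup>2" for x y :: real
    using sum_squares_bound[of x y] by (simp add: power2_sum)
  have "(\<Sum>i = 1..n. (observe 2 N n (\<lambda>x. x) X (column_signal 2 N a j) e i)\<^sup>2)
      = (\<Sum>i = 1..n. (a * (X (i, 1, j) + X (i, 2, j)) + e i)\<^sup>2)"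
    unfolding observe_column_signal[OF j] by (intro sum.cong) (auto simp: numeral_2_eq_2)
  also have "\<dots> \<le> (\<Sum>i = 1..n. 4 * a\<^sup>2 * ((X (i, 1, j))\<^sup>2 + (X (i, 2, j))\<^sup>2) + 2 * (e i)\<^sup>2)"
  proof (rule sum_mono)
    fix i
    have "a\<^sup>2 * (X (i, 1, j) + X (i, 2, j))\<^sup>2 \<le> a\<^sup>2 * (2 * (X (i, 1, j))\<^sup>2 + 2 * (X (i, 2, j))\<^sup>2)"
      by (intro mult_left_mono sq) auto
    moreover have "(a * (X (i, 1, j) + X (i, 2, j)))\<^sup>2 = a\<^sup>2 * (X (i, 1, j) + X (i, 2, j))\<^sup>2"
      by (rule power_mult_distrib)
    moreover have "4 * a\<^sup>2 * ((X (i, 1, j))\<^sup>2 + (X (i, 2, j))\<^sup>2) =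
        2 * (a\<^sup>2 * (2 * (X (i, 1, j))\<^sup>2 + 2 * (X (i, 2, j))\<^sup>2))"
      by (simp add: algebra_simps)
    ultimately show "(a * (X (i, 1, j) + X (i, 2, j)) + e i)\<^sup>2
        \<le> 4 * a\<^sup>2 * ((X (i, 1, j))\<^sup>2 + (X (i, 2, j))\<^sup>2) + 2 * (e i)\<^sup>2"
      using sq[of "a * (X (i, 1, j) + X (i, 2, j))" "e i"] by linarith
  qed
  also have "\<dots> = 4 * a\<^sup>2 * (\<Sum>i = 1..n. (X (i, 1, j))\<^sup>2 + (X (i, 2, j))\<^sup>2) + 2 * (\<Sum>i = 1..n. (e i)\<^sup>2)"
    by (simp only: sum.distrib sum_distrib_left distrib_left)
  also have "(\<Sum>i = 1..n. (X (i, 1, j))\<^sup>2 + (X (i, 2, j))\<^sup>2) = (\<Sum>q\<in>{1..n} \<times> {1..2::nat} \<times> {j}. (X q)\<^sup>2)"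
  proof -
    have "{1..2::nat} \<times> {j} = {(1, j), (2, j)}"
      by (auto simp: numeral_2_eq_2 le_Suc_eq)
    then have pair: "(\<Sum>q\<in>{1..2::nat} \<times> {j}. (X (i, q))\<^sup>2) = (X (i, 1, j))\<^sup>2 + (X (i, 2, j))\<^sup>2" for i
      by simp
    have "(\<Sum>q\<in>{1..n} \<times> {1..2::nat} \<times> {j}. (X q)\<^sup>2) = (\<Sum>i = 1..n. \<Sum>q\<in>{1..2::nat} \<times> {j}. (X (i, q))\<^sup>2)"
      by (simp only: sum.cartesian_product case_prod_beta' prod.collapse)
    also have "\<dots> = (\<Sum>i = 1..n. (X (i, 1, j))\<^sup>2 + (X (i, 2, j))\<^sup>2)"
      by (simp only: pair)
    finally show ?thesis ..
  qed
  also have "4 * a\<^sup>2 * (\<Sum>q\<in>{1..n} \<times> {1..2::nat} \<times> {j}. (X q)\<^sup>2) + 2 * (\<Sum>i = 1..n. (e i)\<^sup>2)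
      \<le> 4 * a\<^sup>2 * 20 + 2 * (10 * v)"
    using X e by (intro add_mono mult_left_mono) auto
  also have "\<dots> = 3220 * v" by (simp add: a)
  finally show ?thesis .
qed

lemma noisy_error:
  assumes \<sigma>: "0 < \<sigma>" and n: "0 < n" and C: "0 < C" "C \<le> 1"
    and N2: "exp (1610 * real n) \<le> N / 2" and \<kappa>: "\<kappa> \<in> procedures 2 N n"
  defines "a \<equiv> 2 * sqrt (10 * real n) * \<sigma>"
  shows "1 / 10 \<le> \<P>((\<beta>, X, e, b) in noisy_law 2 N n \<sigma> (column_signals 2 N a) \<kappa>.
    L2_set (\<lambda>p. \<beta> p - b p) (grid 2 N) \<ge> C * L2_set e {1..n})"
proof -
  \<comment> \<open>The mean of the squared noise norm. The amplitude is set so that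
    \<open>a / 2 = sqrt (10 * v)\<close>, the largest noise norm outside the exceptional event
    \<open>?V\<close>.\<close>
  define v where "v = n * \<sigma>\<^sup>2"
  have v: "0 < v" using \<sigma> n by (simp add: v_def)
  have a: "0 < a" using \<sigma> n by (simp add: a_def)
  have a2: "a\<^sup>2 = 40 * v" by (simp add: a_def v_def power_mult_distrib)
  have N: "1 \<le> N" using N2 exp_gt_zero[of "1610 * real n"] by (cases N) auto
  let ?D = "gaussian_design 2 N n" and ?E = "noise_law n \<sigma>" and ?B = "column_signals 2 N a"
  interpret sensing 2 N n "\<lambda>x. x" ?D ?E ?B \<kappa>
    using \<sigma> by (intro sensing_column_signals gaussian_design_in_prob_algebra noise_law_in_prob_algebra
        measurable_ident_sets refl N \<kappa>) simp
  let ?near = "near 2 N (\<lambda>b. b) 1 (a / 2)"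
  have near: "?near \<beta> \<in> sets S" for \<beta>
    by (rule sets_near) (rule measurable_signal_component)
  have dis: "disjoint_family_on ?near ?B"
    using a by (intro disjoint_near) auto
  have card: "card ?B = N"
    using a by (intro card_column_signals) auto
  \<comment> \<open>Both thresholds are ten times the mean: \<open>v\<close> for the noise, and 2
    for the \<open>2 * n\<close> design entries of variance \<open>1 / n\<close>. Markov's
    inequality then gives \<open>1 / 10\<close> for each event.\<close>
  let ?V = "{e \<in> space ?E. 10 * v < (\<Sum>i = 1..n. (e i)\<^sup>2)}"
  let ?U = "\<lambda>j. {X \<in> space ?D. 20 < (\<Sum>q\<in>{1..n} \<times> {1..2::nat} \<times> {j}. (X q)\<^sup>2)}"
  let ?R = "{y \<in> space (obs_space n). (\<Sum>i = 1..n. (y i)\<^sup>2) \<le> 3220 * v}"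
  have obs_component: "(\<lambda>y. y i) \<in> borel_measurable (obs_space n)" if "i \<in> {1..n}" for i
    unfolding obs_space_def by (rule measurable_component_singleton[OF that])
  have R: "?R \<in> sets (obs_space n)"
    by (intro borel_measurable_le borel_measurable_sum borel_measurable_power obs_component
        borel_measurable_const)
  have V_sets: "?V \<in> sets ?E"
    unfolding sets_E space_E
    by (intro borel_measurable_less borel_measurable_sum borel_measurable_power obs_component
        borel_measurable_const)
  have U_sets: "?U j \<in> sets ?D" if "j \<in> {1..N}" for j
    unfolding sets_D space_D
  proof (intro borel_measurable_less borel_measurable_sum borel_measurable_power borel_measurable_const)
    fix q assume "q \<in> {1..n} \<times> {1..2::nat} \<times> {j}"
    then have "q \<in> {1..n} \<times> grid 2 N" using that by (auto simp: grid_def)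
    then show "(\<lambda>X. X q) \<in> borel_measurable (design_space 2 N n)"
      unfolding design_space_def by (rule measurable_component_singleton)
  qed
  have V: "emeasure ?E ?V \<le> ennreal (1 / 10)"
    using normal_squares_tail[of \<sigma> "{1..n}" "{1..n}" "10 * v"] \<sigma> v n
    unfolding noise_law_def by (simp add: v_def)
  have U: "emeasure ?D (?U j) \<le> ennreal (1 / 10)" if "j \<in> {1..N}" for j
  proof -
    have "{1..n} \<times> {1..2::nat} \<times> {j} \<subseteq> {1..n} \<times> grid 2 N"
      using that by (auto simp: grid_def)
    then show ?thesis
      using normal_squares_tail[of "1 / sqrt n" "{1..n} \<times> {1..2::nat} \<times> {j}" "{1..n} \<times> grid 2 N" 20] n
      unfolding gaussian_design_def by (simp add: card_cartesian_product power_divide)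
  qed
  \<comment> \<open>Success restricted to moderate observations, as a function of the design and the
    observation. Noise enters only through \<open>y\<close>, which makes a change of measure
    possible.\<close>
  let ?g = "\<lambda>\<beta> X y. indicator ?R y * emeasure (\<kappa> (X, y)) (?near \<beta>)"
  have g_measurable: "(\<lambda>z. ?g \<beta> (fst z) (snd z)) \<in> borel_measurable (design_space 2 N n \<Otimes>\<^sub>M obs_space n)" for \<beta>
  proof -
    have "(\<lambda>z. emeasure (\<kappa> z) (?near \<beta>)) \<in> borel_measurable (design_space 2 N n \<Otimes>\<^sub>M obs_space n)"
      by (rule measurable_compose[OF measurable_prob_algebraD[OF kernel_measurable]
            measurable_emeasure_subprob_algebra[OF near]])
    then show ?thesis
      unfolding prod.collapse
      by (intro borel_measurable_times_ennreal measurable_compose[OF measurable_snd borel_measurable_indicator[OF R]])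
  qed
  \<comment> \<open>The event of a small error, that is, the complement of the event in the
    claim.\<close>
  let ?bad = "\<lambda>\<beta> X e. {b \<in> space S. \<not> C * L2_set e {1..n} \<le> L2_set (\<lambda>p. \<beta> p - b p) (grid 2 N)}"
  \<comment> \<open>On the exceptional events the trivial bound 1 is taken. Elsewhere the
    observation lies in \<open>?R\<close>, and an error below \<open>C * L2_set e {1..n}\<close> is
    below \<open>a / 2\<close>, so the estimate is near \<beta>.\<close>
  have bad_le: "emeasure (estimate \<beta> X e) (?bad \<beta> X e) \<le>
      indicator (?U j) X + (indicator ?V e + ?g \<beta> X (observe 2 N n (\<lambda>x. x) X \<beta> e))"
    if j: "j \<in> {1..N}" and \<beta>: "\<beta> = column_signal 2 N a j" and X: "X \<in> space ?D" and e: "e \<in> space ?E"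
    for \<beta> j X e
  proof (cases "X \<in> ?U j \<or> e \<in> ?V")
    case True
    interpret K: prob_space "estimate \<beta> X e"
      using X by (intro estimate_prob observe_space) simp
    have "emeasure (estimate \<beta> X e) (?bad \<beta> X e) \<le> 1" by (rule K.emeasure_le_1)
    also have "\<dots> \<le> indicator (?U j) X + (indicator ?V e + ?g \<beta> X (observe 2 N n (\<lambda>x. x) X \<beta> e))"
    proof (cases "X \<in> ?U j")
      case False
      then have "(1::ennreal) = indicator ?V e" using True by (simp only: indicator_simps simp_thms)
      also have "\<dots> \<le> indicator ?V e + ?g \<beta> X (observe 2 N n (\<lambda>x. x) X \<beta> e)"
        by (rule le_iff_add[THEN iffD2]) blast
      also have "\<dots> \<le> indicator (?U j) X + \<dots>"
        by (rule add_increasing) simp_all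
      finally show ?thesis .
    qed (simp only: indicator_simps le_iff_add, blast)
    finally show ?thesis .
  next
    case False
    then have X': "(\<Sum>q\<in>{1..n} \<times> {1..2::nat} \<times> {j}. (X q)\<^sup>2) \<le> 20" and e': "(\<Sum>i = 1..n. (e i)\<^sup>2) \<le> 10 * v"
      using X e by auto
    have "observe 2 N n (\<lambda>x. x) X \<beta> e \<in> ?R"
      using observe_squares_le[OF j X' e' a2] observe_space by (simp add: \<beta>)
    moreover have "?bad \<beta> X e \<subseteq> ?near \<beta>"
    proof
      fix b assume "b \<in> ?bad \<beta> X e"
      then have "b \<in> space S" and b: "L2_set (\<lambda>p. \<beta> p - b p) (grid 2 N) < C * L2_set e {1..n}"
        by (simp_all only: mem_Collect_eq not_le)
      have "\<bar>b p - \<beta> p\<bar> < a / 2" if p: "p \<in> grid 2 N" for p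
      proof -
        have "\<bar>b p - \<beta> p\<bar> \<le> L2_set (\<lambda>p. \<beta> p - b p) (grid 2 N)"
          using abs_le_L2_set[OF finite_grid p, of "\<lambda>p. \<beta> p - b p"] by (simp add: abs_minus_commute)
        also have "\<dots> < C * L2_set e {1..n}" by (rule b)
        also have "\<dots> \<le> 1 * L2_set e {1..n}" by (intro mult_right_mono C) simp
        also have "\<dots> \<le> sqrt (10 * v)" using e' by (simp add: L2_set_def)
        also have "\<dots> = a / 2" using \<sigma> by (simp add: a_def v_def real_sqrt_mult)
        finally show ?thesis .
      qed
      then show "b \<in> ?near \<beta>" using \<open>b \<in> space S\<close> by (simp add: near_def)
    qed
    then have "emeasure (estimate \<beta> X e) (?bad \<beta> X e) \<le> emeasure (estimate \<beta> X e) (?near \<beta>)"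
      using X near by (intro emeasure_mono) (auto simp: estimate_prob(2)[OF _ observe_space])
    ultimately show ?thesis
      by (simp add: add_increasing)
  qed
  \<comment> \<open>The law of the observation is replaced by pure noise, which is the same for all
    signals. On \<open>?R\<close> the exponent is at most
    \<open>3220 * v / (2 * \<sigma>\<^sup>2) = 1610 * n\<close>; off \<open>?R\<close> the integrand
    vanishes.\<close>
  have shift: "(\<integral>\<^sup>+e. ?g \<beta> X (observe 2 N n (\<lambda>x. x) X \<beta> e) \<partial>?E)
      \<le> ennreal (exp (1610 * n)) * (\<integral>\<^sup>+y. ?g \<beta> X y \<partial>?E)"
    if X: "X \<in> space ?D" for \<beta> X
  proof -
    from X have X': "X \<in> space (design_space 2 N n)" by simp
    have gX: "?g \<beta> X \<in> borel_measurable (Pi\<^sub>M {1..n} (\<lambda>_. borel))"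
      using measurable_compose[OF measurable_Pair1'[OF X'] g_measurable]
      by (simp only: fst_conv snd_conv obs_space_def)
    have "(\<integral>\<^sup>+e. ?g \<beta> X (observe 2 N n (\<lambda>x. x) X \<beta> e) \<partial>?E)
        \<le> (\<integral>\<^sup>+y. ?g \<beta> X y * ennreal (exp ((\<Sum>i = 1..n. (y i)\<^sup>2) / (2 * \<sigma>\<^sup>2))) \<partial>?E)"
      unfolding observe_def noise_law_def
      by (rule nn_integral_PiM_normal_law_shift_le[OF \<sigma> finite_atLeastAtMost gX])
    also have "\<dots> \<le> (\<integral>\<^sup>+y. ennreal (exp (1610 * n)) * ?g \<beta> X y \<partial>?E)"
    proof (rule nn_integral_mono)
      fix y
      show "?g \<beta> X y * ennreal (exp ((\<Sum>i = 1..n. (y i)\<^sup>2) / (2 * \<sigma>\<^sup>2))) \<le> ennreal (exp (1610 * n)) * ?g \<beta> X y"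
      proof (cases "y \<in> ?R")
        case True
        then have "(\<Sum>i = 1..n. (y i)\<^sup>2) / (2 * \<sigma>\<^sup>2) \<le> 1610 * n"
          using \<sigma> by (simp add: v_def divide_simps)
        then have "ennreal (exp ((\<Sum>i = 1..n. (y i)\<^sup>2) / (2 * \<sigma>\<^sup>2))) \<le> ennreal (exp (1610 * n))"
          by (intro ennreal_leI) simp
        then show ?thesis
          unfolding mult.commute[of "ennreal (exp (1610 * n))"] by (rule mult_left_mono) simp
      qed simp
    qed
    also have "\<dots> = ennreal (exp (1610 * n)) * (\<integral>\<^sup>+y. ?g \<beta> X y \<partial>?E)"
    proof (rule nn_integral_cmult)
      have "sets ?E = sets (Pi\<^sub>M {1..n} (\<lambda>_. borel))"
        using sets_E by (simp only: obs_space_def)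
      then have "borel_measurable ?E = borel_measurable (Pi\<^sub>M {1..n} (\<lambda>_. borel))"
        by (rule measurable_cong_sets) (rule refl)
      then show "?g \<beta> X \<in> borel_measurable ?E" using gX by (rule ssubst)
    qed
    finally show ?thesis .
  qed
  let ?c = "ennreal (exp (1610 * n))"
  let ?I = "\<lambda>\<beta>. \<integral>\<^sup>+X. \<integral>\<^sup>+y. ?g \<beta> X y \<partial>?E \<partial>?D"
  have g_inner: "(\<lambda>e. ?g \<beta> X (observe 2 N n (\<lambda>x. x) X \<beta>' e)) \<in> borel_measurable ?E"
    if X: "X \<in> space ?D" for \<beta> \<beta>' X
  proof -
    from X have X': "X \<in> space (design_space 2 N n)" by simp
    have "(\<lambda>e. observe 2 N n (\<lambda>x. x) X \<beta>' e) \<in> obs_space n \<rightarrow>\<^sub>M obs_space n"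
      using measurable_compose[OF measurable_Pair1'[OF X'] measurable_observe[OF h]]
      by (simp only: fst_conv snd_conv)
    from measurable_compose[OF measurable_compose[OF this measurable_Pair1'[OF X']] g_measurable]
    show ?thesis
      unfolding measurable_cong_sets[OF sets_E refl] by (simp only: fst_conv snd_conv)
  qed
  have g_outer: "(\<lambda>X. \<integral>\<^sup>+y. ?g \<beta> X y \<partial>?E) \<in> borel_measurable ?D" for \<beta>
  proof (rule E.borel_measurable_nn_integral)
    show "(\<lambda>(X, y). ?g \<beta> X y) \<in> borel_measurable (?D \<Otimes>\<^sub>M ?E)"
      unfolding measurable_cong_sets[OF sets_pair_measure_cong[OF sets_D sets_E] refl] case_prod_beta'
      by (rule g_measurable)
  qed
  have each: "(\<integral>\<^sup>+X. \<integral>\<^sup>+e. emeasure (estimate \<beta> X e) (?bad \<beta> X e) \<partial>?E \<partial>?D) \<le> ennreal (1 / 5) + ?c * ?I \<beta>"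
    if "\<beta> \<in> ?B" for \<beta>
  proof -
    from that obtain j where j: "j \<in> {1..N}" and \<beta>: "\<beta> = column_signal 2 N a j"
      by (auto simp: column_signals_def)
    have "(\<integral>\<^sup>+X. \<integral>\<^sup>+e. emeasure (estimate \<beta> X e) (?bad \<beta> X e) \<partial>?E \<partial>?D)
        \<le> (\<integral>\<^sup>+X. indicator (?U j) X + (ennreal (1 / 10) + ?c * (\<integral>\<^sup>+y. ?g \<beta> X y \<partial>?E)) \<partial>?D)"
    proof (rule nn_integral_mono)
      fix X assume X: "X \<in> space ?D"
      have "(\<integral>\<^sup>+e. emeasure (estimate \<beta> X e) (?bad \<beta> X e) \<partial>?E)
          \<le> (\<integral>\<^sup>+e. indicator (?U j) X + (indicator ?V e + ?g \<beta> X (observe 2 N n (\<lambda>x. x) X \<beta> e)) \<partial>?E)"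
        by (intro nn_integral_mono bad_le j \<beta> X)
      also have "\<dots> = indicator (?U j) X +
          (emeasure ?E ?V + (\<integral>\<^sup>+e. ?g \<beta> X (observe 2 N n (\<lambda>x. x) X \<beta> e) \<partial>?E))"
        by (simp only: nn_integral_add[OF borel_measurable_const
              borel_measurable_add[OF borel_measurable_indicator[OF V_sets] g_inner[OF X]]]
            nn_integral_add[OF borel_measurable_indicator[OF V_sets] g_inner[OF X]]
            nn_integral_indicator[OF V_sets] nn_integral_const E.emeasure_space_1 mult_1_right)
      also have "\<dots> \<le> indicator (?U j) X + (ennreal (1 / 10) + ?c * (\<integral>\<^sup>+y. ?g \<beta> X y \<partial>?E))"
        by (intro add_mono order_refl V shift X)
      finally show "(\<integral>\<^sup>+e. emeasure (estimate \<beta> X e) (?bad \<beta> X e) \<partial>?E)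
        \<le> indicator (?U j) X + (ennreal (1 / 10) + ?c * (\<integral>\<^sup>+y. ?g \<beta> X y \<partial>?E))" .
    qed
    also have "\<dots> = emeasure ?D (?U j) + (ennreal (1 / 10) + ?c * ?I \<beta>)"
    proof -
      have c: "(\<lambda>X. ?c * (\<integral>\<^sup>+y. ?g \<beta> X y \<partial>?E)) \<in> borel_measurable ?D"
        by (intro borel_measurable_times_ennreal borel_measurable_const g_outer)
      show ?thesis
        by (simp only: nn_integral_add[OF borel_measurable_indicator[OF U_sets[OF j]]
              borel_measurable_add[OF borel_measurable_const c]]
            nn_integral_add[OF borel_measurable_const c] nn_integral_indicator[OF U_sets[OF j]]
            nn_integral_cmult[OF g_outer] nn_integral_const D.emeasure_space_1 mult_1_right)
    qed
    also have "\<dots> \<le> ennreal (1 / 10) + (ennreal (1 / 10) + ?c * ?I \<beta>)"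
      by (intro add_mono order_refl U j)
    also have "\<dots> = ennreal (1 / 5) + ?c * ?I \<beta>"
      by (simp add: add.assoc [symmetric] flip: ennreal_plus)
    finally show ?thesis .
  qed
  \<comment> \<open>Under pure noise all signals share one law of the data, so disjointness bounds
    the summed success probability by 1 for every \<open>X\<close> and \<open>y\<close>.\<close>
  have "(\<Sum>\<beta>\<in>?B. ?I \<beta>) = (\<integral>\<^sup>+X. \<integral>\<^sup>+y. (\<Sum>\<beta>\<in>?B. ?g \<beta> X y) \<partial>?E \<partial>?D)"
    by (rule sum_nn_integral_swap) (rule g_measurable)
  also have "\<dots> \<le> (\<integral>\<^sup>+X. \<integral>\<^sup>+y. 1 \<partial>?E \<partial>?D)"
  proof (intro nn_integral_mono)
    fix X y assume "X \<in> space ?D" "y \<in> space ?E"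
    then have "(\<Sum>\<beta>\<in>?B. emeasure (\<kappa> (X, y)) (?near \<beta>)) \<le> 1"
      by (intro kernel_disjoint_le_1 near dis) auto
    then show "(\<Sum>\<beta>\<in>?B. ?g \<beta> X y) \<le> 1"
      by (simp add: indicator_def flip: sum_distrib_left)
  qed
  also have "\<dots> = 1"
    by (simp only: nn_integral_const D.emeasure_space_1 E.emeasure_space_1 mult_1_right)
  finally have I: "(\<Sum>\<beta>\<in>?B. ?I \<beta>) \<le> 1" .
  have "(\<Sum>\<beta>\<in>?B. \<integral>\<^sup>+X. \<integral>\<^sup>+e. emeasure (estimate \<beta> X e) (?bad \<beta> X e) \<partial>?E \<partial>?D)
      \<le> (\<Sum>\<beta>\<in>?B. ennreal (1 / 5) + ?c * ?I \<beta>)"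
    by (intro sum_mono each)
  also have "\<dots> = ennreal (N / 5) + ?c * (\<Sum>\<beta>\<in>?B. ?I \<beta>)"
    by (simp add: sum.distrib sum_distrib_left card ennreal_of_nat_eq_real_of_nat flip: ennreal_mult)
  also have "\<dots> \<le> ennreal (N / 5) + ?c * 1"
    by (intro add_mono mult_left_mono I) auto
  also have "\<dots> = ennreal (N / 5 + exp (1610 * n))"
    by simp
  \<comment> \<open>By the size condition the sum is at most \<open>N / 5 + N / 2\<close>, that is,
    7/10 of \<open>N\<close>, which leaves room below 9/10.\<close>
  also have "\<dots> \<le> ennreal (9 / 10 * card ?B)"
    unfolding card using N2 by (intro ennreal_leI) simp
  finally have "1 - 9 / 10 \<le> \<P>((\<beta>, X, e, b) in joint_law 2 N n (\<lambda>x. x) ?D ?E ?B \<kappa>.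
      L2_set (\<lambda>p. \<beta> p - b p) (grid 2 N) \<ge> C * L2_set e {1..n})"
  proof (intro prob_joint_law_ge)
    show "{\<omega> \<in> space T. C * L2_set (fst (snd (snd \<omega>))) {1..n}
        \<le> L2_set (\<lambda>p. fst \<omega> p - snd (snd (snd \<omega>)) p) (grid 2 N)} \<in> sets T"
    proof (intro borel_measurable_le borel_measurable_times borel_measurable_const measurable_L2_set
        borel_measurable_diff)
      show "(\<lambda>\<omega>. fst (snd (snd \<omega>)) i) \<in> borel_measurable T" if "i \<in> {1..n}" for i
        by (rule measurable_compose[OF measurable_snd measurable_compose[OF measurable_snd
                measurable_compose[OF measurable_fst obs_component[OF that]]]])
      show "(\<lambda>\<omega>. fst \<omega> p) \<in> borel_measurable T" if "p \<in> grid 2 N" for p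
        by (rule measurable_compose[OF measurable_fst measurable_signal_component[OF that]])
      show "(\<lambda>\<omega>. snd (snd (snd \<omega>)) p) \<in> borel_measurable T" if "p \<in> grid 2 N" for p
        by (rule measurable_compose[OF measurable_snd measurable_compose[OF measurable_snd
                measurable_compose[OF measurable_snd measurable_signal_component[OF that]]]])
    qed
  qed auto
  then show ?thesis
    by (simp add: noisy_law_def)
qed

section \<open>Asymptotics along the family and conclusion\<close>

lemma eventually_exp_le:
  fixes n :: "nat \<Rightarrow> nat"
  assumes "(\<lambda>m. real (n m)) \<in> o(\<lambda>m. complexity 2 (m + 1) 1)"
  shows "\<forall>\<^sub>F m in sequentially. exp (1610 * real (n m)) \<le> real (m + 1) / 2"
proof -
  \<comment> \<open>Halving the argument costs only the constant \<open>ln 2\<close>, and half of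
    the growing logarithm eventually absorbs any constant.\<close>
  have "\<forall>\<^sub>F m in sequentially. 3 + ln (real (m + 1)) / 2 \<le> ln (real (m + 1) / 2)"
    by real_asymp
  \<comment> \<open>The factor is \<open>1 / (2 * 1610)\<close>, so that \<open>1610 * n m\<close>
    is at most half of the complexity \<open>2 + ln (m + 1)\<close>.\<close>
  moreover have "\<forall>\<^sub>F m in sequentially. norm (real (n m)) \<le> 1 / 3220 * norm (complexity 2 (m + 1) 1)"
    using assms by (rule landau_o.smallD) simp
  ultimately show ?thesis
  proof eventually_elim
    case (elim m)
    have "complexity 2 (m + 1) 1 = 2 + ln (real (m + 1))"
      by (simp add: complexity_def)
    moreover have "0 \<le> ln (real (m + 1))" by simp
    ultimately have "1610 * real (n m) \<le> 1 + ln (real (m + 1)) / 2"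
      using elim(2) by simp
    also have "\<dots> \<le> ln (real (m + 1) / 2)"
      using elim(1) by simp
    finally have "exp (1610 * real (n m)) \<le> exp (ln (real (m + 1) / 2))"
      by (rule exp_le_cancel_iff[THEN iffD2])
    then show ?case by simp
  qed
qed

text \<open>Two rows give \<open>s = 2\<close>, so \<open>ln s\<close> is a positive constant and
  the quotient diverges along with the complexity. With a single row \<open>ln s\<close> would be 0
  and the quotient, by division by 0, constantly 0. The shift in \<open>m + 1\<close> provides a
  column at \<open>m = 0\<close>.\<close>

lemma block_family_columns: "block_family (\<lambda>_. 2) (\<lambda>m. m + 1) (\<lambda>_. 1)"
  unfolding block_family_def complexity_def
  by (intro conjI allI) (simp_all, real_asymp+)

theorem corollary2:
  "\<exists>J N K :: nat \<Rightarrow> nat. block_family J N K \<and>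
    \<comment> \<open>noisy standard compressed sensing\<close>
    (\<exists>(C0::real) B. 0 < C0 \<and>
      (\<forall>m n \<sigma>. 0 < n \<and> 0 < \<sigma> \<longrightarrow> signal_ensemble (J m) (N m) (K m) (B m n \<sigma>)) \<and>
      (\<forall>n :: nat \<Rightarrow> nat.
        (\<forall>m. 0 < n m) \<and>
        (\<lambda>m. real (n m)) \<in> o(\<lambda>m. complexity (J m) (N m) (K m) / ln (real (J m * K m))) \<longrightarrow>
        (\<forall>\<^sub>F m in sequentially. \<forall>\<sigma>>0. \<forall>C. 0 < C \<and> C \<le> C0 \<longrightarrow>
          (\<forall>\<kappa> \<in> procedures (J m) (N m) (n m).
            \<P>((\<beta>, X, e, b) in noisy_law (J m) (N m) (n m) \<sigma> (B m (n m) \<sigma>) \<kappa>.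
              L2_set (\<lambda>p. \<beta> p - b p) (grid (J m) (N m)) \<ge> C * L2_set e {1..n m}) \<ge> 1 / 10)))) \<and>
    \<comment> \<open>noiseless standard compressed sensing\<close>
    (\<exists>B.
      (\<forall>m n. 0 < n \<longrightarrow> signal_ensemble (J m) (N m) (K m) (B m n)) \<and>
      (\<forall>n :: nat \<Rightarrow> nat.
        (\<forall>m. 0 < n m) \<and>
        (\<lambda>m. real (n m)) \<in> o(\<lambda>m. complexity (J m) (N m) (K m) / ln (real (J m * K m))) \<longrightarrow>
        (\<forall>\<^sub>F m in sequentially.
          (\<forall>\<kappa> \<in> procedures (J m) (N m) (n m).
            \<P>((\<beta>, X, e, b) in noiseless_law (J m) (N m) (n m) (B m (n m)) \<kappa>.
              \<beta> \<noteq> b) \<ge> 1 / 2)))) \<and>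
    \<comment> \<open>one-bit compressed sensing, with Gaussian noise or (\<open>\<sigma> = 0\<close>) without noise\<close>
    (\<exists>B.
      (\<forall>m n \<sigma>. 0 < n \<and> 0 \<le> \<sigma> \<longrightarrow> signal_ensemble (J m) (N m) (K m) (B m n \<sigma>)) \<and>
      (\<exists>\<epsilon> :: nat \<Rightarrow> real. (\<forall>m. 0 < \<epsilon> m) \<and>
        (\<forall>n :: nat \<Rightarrow> nat.
          (\<forall>m. 0 < n m) \<and>
          (\<lambda>m. real (n m)) \<in> o(\<lambda>m. complexity (J m) (N m) (K m)) \<longrightarrow>
          (\<forall>\<^sub>F m in sequentially. \<forall>\<sigma>\<ge>0. \<forall>c\<in>{-1, 1}.
            (\<forall>\<kappa> \<in> nonzero_procedures (J m) (N m) (n m).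
              \<P>((\<beta>, X, e, b) in one_bit_law (J m) (N m) (n m) \<sigma> c (B m (n m) \<sigma>) \<kappa>.
                L2_set (\<lambda>p. b p / L2_set b (grid (J m) (N m)) - \<beta> p / L2_set \<beta> (grid (J m) (N m)))
                  (grid (J m) (N m)) \<ge> \<epsilon> m) \<ge> 1 / 2)))) \<and>
      (\<forall>n :: nat \<Rightarrow> nat.
        (\<forall>m. 0 < n m) \<and>
        (\<lambda>m. real (n m)) \<in> o(\<lambda>m. complexity (J m) (N m) (K m)) \<longrightarrow>
        (\<forall>\<^sub>F m in sequentially. \<forall>\<sigma>\<ge>0. \<forall>c\<in>{-1, 1}.
          (\<forall>\<kappa> \<in> procedures (J m) (N m) (n m).
            \<P>((\<beta>, X, e, b) in one_bit_law (J m) (N m) (n m) \<sigma> c (B m (n m) \<sigma>) \<kappa>.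
              b \<noteq> \<beta>) \<ge> 1 / 2))))"
proof (intro exI conjI)
  let ?J = "\<lambda>_::nat. 2::nat" and ?N = "\<lambda>m::nat. m + 1" and ?K = "\<lambda>_::nat. 1::nat"
  \<comment> \<open>The noisy ensemble scales with \<sigma> and \<open>sqrt n\<close>. In the other
    settings the number of possible observations is bounded independently of the noise level, and
    amplitude 1 is taken.\<close>
  let ?a = "\<lambda>(n::nat) (\<sigma>::real). 2 * sqrt (10 * real n) * \<sigma>"
  \<comment> \<open>Here \<open>ln s\<close> is the constant \<open>ln 2\<close>, so the condition
    with the logarithmic factor reduces to the plain one.\<close>
  have small: "\<forall>\<^sub>F m in sequentially. exp (1610 * real (n m)) \<le> real (m + 1) / 2"
    if "(\<lambda>m. real (n m)) \<in> o(\<lambda>m. complexity 2 (m + 1) 1 / ln (real (2 * 1)))" for n :: "nat \<Rightarrow> nat"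
    using that by (intro eventually_exp_le) simp
  show "block_family ?J ?N ?K"
    by (rule block_family_columns)
  \<comment> \<open>The witness for \<open>C0\<close> is 1: \<open>noisy_error\<close> compares
    \<open>C\<close> times the noise norm with the noise norm itself.\<close>
  show "(0::real) < 1" by simp
  show "\<forall>m n \<sigma>. 0 < n \<and> 0 < \<sigma> \<longrightarrow> signal_ensemble 2 (m + 1) 1 (column_signals 2 (m + 1) (?a n \<sigma>))"
    by (intro allI impI signal_ensemble_column_signals) auto
  show "\<forall>n. (\<forall>m. 0 < n m) \<and>
      (\<lambda>m. real (n m)) \<in> o(\<lambda>m. complexity 2 (m + 1) 1 / ln (real (2 * 1))) \<longrightarrow>
      (\<forall>\<^sub>F m in sequentially. \<forall>\<sigma>>0. \<forall>C. 0 < C \<and> C \<le> 1 \<longrightarrow>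
        (\<forall>\<kappa> \<in> procedures 2 (m + 1) (n m).
          \<P>((\<beta>, X, e, b) in noisy_law 2 (m + 1) (n m) \<sigma> (column_signals 2 (m + 1) (?a (n m) \<sigma>)) \<kappa>.
            L2_set (\<lambda>p. \<beta> p - b p) (grid 2 (m + 1)) \<ge> C * L2_set e {1..n m}) \<ge> 1 / 10))"
  proof (intro allI impI, elim conjE)
    fix n :: "nat \<Rightarrow> nat"
    assume "\<forall>m. 0 < n m" and "(\<lambda>m. real (n m)) \<in> o(\<lambda>m. complexity 2 (m + 1) 1 / ln (real (2 * 1)))"
    from small[OF this(2)] this(1) show "\<forall>\<^sub>F m in sequentially. \<forall>\<sigma>>0. \<forall>C. 0 < C \<and> C \<le> 1 \<longrightarrow>
        (\<forall>\<kappa> \<in> procedures 2 (m + 1) (n m).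
          \<P>((\<beta>, X, e, b) in noisy_law 2 (m + 1) (n m) \<sigma> (column_signals 2 (m + 1) (?a (n m) \<sigma>)) \<kappa>.
            L2_set (\<lambda>p. \<beta> p - b p) (grid 2 (m + 1)) \<ge> C * L2_set e {1..n m}) \<ge> 1 / 10)"
      by (elim eventually_mono) (intro allI impI ballI noisy_error, auto)
  qed
  show "\<forall>m n. 0 < n \<longrightarrow> signal_ensemble 2 (m + 1) 1 (column_signals 2 (m + 1) 1)"
    by (intro allI impI signal_ensemble_column_signals) auto
  show "\<forall>n. (\<forall>m. 0 < n m) \<and>
      (\<lambda>m. real (n m)) \<in> o(\<lambda>m. complexity 2 (m + 1) 1 / ln (real (2 * 1))) \<longrightarrow>
      (\<forall>\<^sub>F m in sequentially. \<forall>\<kappa> \<in> procedures 2 (m + 1) (n m).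
        \<P>((\<beta>, X, e, b) in noiseless_law 2 (m + 1) (n m) (column_signals 2 (m + 1) 1) \<kappa>. \<beta> \<noteq> b) \<ge> 1 / 2)"
    by (intro allI impI, elim conjE, drule small, elim eventually_mono) (intro ballI noiseless_exact)
  show "\<forall>m n \<sigma>. 0 < n \<and> 0 \<le> \<sigma> \<longrightarrow> signal_ensemble 2 (m + 1) 1 (column_signals 2 (m + 1) 1)"
    by (intro allI impI signal_ensemble_column_signals) auto
  \<comment> \<open>The threshold of \<open>one_bit_direction\<close> for two rows, constant in
    \<open>m\<close>.\<close>
  show "\<forall>m::nat. 0 < 1 / (2 * sqrt (real 2))"
    by simp
  show "\<forall>n. (\<forall>m. 0 < n m) \<and> (\<lambda>m. real (n m)) \<in> o(\<lambda>m. complexity 2 (m + 1) 1) \<longrightarrow>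
      (\<forall>\<^sub>F m in sequentially. \<forall>\<sigma>\<ge>0. \<forall>c\<in>{-1, 1}. \<forall>\<kappa> \<in> nonzero_procedures 2 (m + 1) (n m).
        \<P>((\<beta>, X, e, b) in one_bit_law 2 (m + 1) (n m) \<sigma> c (column_signals 2 (m + 1) 1) \<kappa>.
          L2_set (\<lambda>p. b p / L2_set b (grid 2 (m + 1)) - \<beta> p / L2_set \<beta> (grid 2 (m + 1)))
            (grid 2 (m + 1)) \<ge> 1 / (2 * sqrt (real 2))) \<ge> 1 / 2)"
  proof (intro allI impI, elim conjE)
    fix n :: "nat \<Rightarrow> nat"
    assume "(\<lambda>m. real (n m)) \<in> o(\<lambda>m. complexity 2 (m + 1) 1)"
    from eventually_exp_le[OF this]
    show "\<forall>\<^sub>F m in sequentially. \<forall>\<sigma>\<ge>0. \<forall>c\<in>{-1, 1}. \<forall>\<kappa> \<in> nonzero_procedures 2 (m + 1) (n m).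
        \<P>((\<beta>, X, e, b) in one_bit_law 2 (m + 1) (n m) \<sigma> c (column_signals 2 (m + 1) 1) \<kappa>.
          L2_set (\<lambda>p. b p / L2_set b (grid 2 (m + 1)) - \<beta> p / L2_set \<beta> (grid 2 (m + 1)))
            (grid 2 (m + 1)) \<ge> 1 / (2 * sqrt (real 2))) \<ge> 1 / 2"
      by (elim eventually_mono)
        (intro allI impI ballI one_bit_direction, simp_all add: nonzero_procedures_def)
  qed
  show "\<forall>n. (\<forall>m. 0 < n m) \<and> (\<lambda>m. real (n m)) \<in> o(\<lambda>m. complexity 2 (m + 1) 1) \<longrightarrow>
      (\<forall>\<^sub>F m in sequentially. \<forall>\<sigma>\<ge>0. \<forall>c\<in>{-1, 1}. \<forall>\<kappa> \<in> procedures 2 (m + 1) (n m).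
        \<P>((\<beta>, X, e, b) in one_bit_law 2 (m + 1) (n m) \<sigma> c (column_signals 2 (m + 1) 1) \<kappa>. b \<noteq> \<beta>) \<ge> 1 / 2)"
  proof (intro allI impI, elim conjE)
    fix n :: "nat \<Rightarrow> nat"
    assume "(\<lambda>m. real (n m)) \<in> o(\<lambda>m. complexity 2 (m + 1) 1)"
    from eventually_exp_le[OF this]
    show "\<forall>\<^sub>F m in sequentially. \<forall>\<sigma>\<ge>0. \<forall>c\<in>{-1, 1}. \<forall>\<kappa> \<in> procedures 2 (m + 1) (n m).
        \<P>((\<beta>, X, e, b) in one_bit_law 2 (m + 1) (n m) \<sigma> c (column_signals 2 (m + 1) 1) \<kappa>. b \<noteq> \<beta>) \<ge> 1 / 2"
      by (elim eventually_mono) (intro allI impI ballI one_bit_exact, simp_all)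
  qed
qed

end
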